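(* Let $\log$ denote the base-2 logarithm and $H(t)=-t\log t-(1-t)\log(1-t)$ the binary entropy function. Let $p_1=\frac{3\log(4/3)}{2+3\log(4/3)}\approx 0.384$. For $p\in(p_1,1/2)$ let $$G_p(x)=(1-x)H\!\left(\frac{p-x}{1-x}\right)-1+2x,$$ and let $r(p)$ be the unique root $x$ of $G_p(x)=0$ in the interval $[0,\frac32p-\frac12]$. Define $$R_L(p)=\begin{cases}1-\dfrac{p}{\log(4/3)}, & 0\le p\le p_1,\\[1ex] r(p), & p_1<p<1/2,\\[0.5ex] 0,& 1/2\le p\le 1.\end{cases}$$ Then for all $p\in[0,1]$ the rate $R_L(p)$ is achievable for the class $\mathsf{CE}_p$ of $p$-bounded causal binary erasure channels, and hence the capacity satisfies $C_p\ge R_L(p)$.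
   Context: Alphabets: $\mathcal{X}=\{0,1\}$, $\mathcal{Y}=\{0,1,\wedge\}$, where $\wedge$ denotes an erasure. Causal erasure channels. For $p\in[0,1]$ and blocklength $n$, a channel $\mathbf{Adv}\in\mathsf{CE}_p$ is given by (possibly randomized) functions $\mathrm{Adv}^i:\mathcal{X}^i\times\mathcal{Y}^{i-1}\to\mathcal{Y}$, $i=1,\dots,n$. At time $i$ the channel maps the inputs $x_1,\dots,x_i$ observed so far and its own previous outputs $y_1,\dots,y_{i-1}$ to an output symbol $y_i\in\{x_i,\wedge\}$, subject to the constraint that the total number of erased symbols in $\mathbf{y}=(y_1,\dots,y_n)$ is at most $pn$. Apart from causality and this bound, the channel's behavior is arbitrary. Write $\mathbf{Adv}(\mathbf{x})$ for the (random) output word when the input is $\mathbf{x}\in\mathcal{X}^n$. Codes. For $R\ge 0$, a $(2^{nR},n)$ code is a pair $(\mathsf{Enc},\mathsf{Dec})$ with message set $\mathcal{U}=\{0,1\}^{\lceil nR\rceil}$, a stochastic encoder $\mathsf{Enc}:\mathcal{U}\to\mathcal{X}^n$ and a (possibly randomized) decoder $\mathsf{Dec}:\mathcal{Y}^n\to\mathcal{U}$. Encoder and decoder share no randomness. The encoder is assumed injective: for all distinct messages $u,u'$, $\mathsf{Enc}(u)\ne\mathsf{Enc}(u')$ with probability $1$ (i.e. the sets of possible codewords of distinct messages are disjoint). Error probability. For a code and a channel, $$P_{\max}^n=\max_{u\in\mathcal{U}}\sum_{\mathbf{x}\in\mathcal{X}^n}\Pr(\mathsf{Enc}(u)=\mathbf{x})\sum_{\mathbf{y}\in\mathcal{Y}^n}\Pr(\mathbf{Adv}(\mathbf{x})=\mathbf{y})\Pr(\mathsf{Dec}(\mathbf{y})\ne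 u).$$ Achievability and capacity. A rate $R\ge 0$ is achievable for $\mathsf{CE}_p$ if for every $\epsilon>0$ there is a sequence, indexed by $n\ge1$, of $(2^{n(R-\epsilon)},n)$ codes (with a single-message set if $R-\epsilon\le 0$) such that for every $\beta>0$ there is an integer $n_\beta$ such that for all $\mathbf{Adv}\in\mathsf{CE}_p$, $P_{\max}^n<\beta$ for all $n>n_\beta$. (In particular the channel may depend on the code.) The capacity $C_p$ is the supremum of all achievable rates for $\mathsf{CE}_p$. *)

theory Defs
  imports "HOL-Probability.Probability"
begin

text \<open>
  The input alphabet is \<^typ>\<open>bool\<close>, the output alphabet is \<^typ>\<open>bool option\<close>, with
  \<^const>\<open>None\<close> as the erasure symbol. Words are lists; randomized functions are functions into
  \<^verbatim>\<open>pmf\<close>.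
\<close>

type_synonym symbol = "bool option"

definition words :: "nat \<Rightarrow> 'a list set" where
  "words n = {w. length w = n}"


subsection \<open>Causal erasure channels\<close>

text \<open>
  The function used at time \<open>i\<close> is the restriction of the channel to input prefixes of length
  \<open>i\<close> and output prefixes of length \<open>i - 1\<close>, so the time index is carried by the list lengths.
  Fresh randomness at every step is no restriction compared to randomness shared between the
  steps: as the channel sees all its former inputs and outputs, any randomized causal strategy has
  the same input-output law as one given by such conditional distributions.
\<close>

type_synonym channel = "bool list \<Rightarrow> symbol list \<Rightarrow> symbol pmf"

primrec output_prefix :: "channel \<Rightarrow> bool list \<Rightarrow> nat \<Rightarrow> symbol list pmf" where
  "output_prefix Adv x 0 = return_pmf []"
| "output_prefix Adv x (Suc i) =
     bind_pmf (output_prefix Adv x i)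
       (\<lambda>ys. map_pmf (\<lambda>y. ys @ [y]) (Adv (take (Suc i) x) ys))"

definition channel_output :: "channel \<Rightarrow> bool list \<Rightarrow> symbol list pmf" where
  "channel_output Adv x = output_prefix Adv x (length x)"

definition CE :: "real \<Rightarrow> nat \<Rightarrow> channel set" where
  "CE p n = {Adv.
     (\<forall>i\<in>{1..n}. \<forall>xs\<in>words i. \<forall>ys\<in>words (i - 1).
        set_pmf (Adv xs ys) \<subseteq> {Some (last xs), None}) \<and>
     (\<forall>x\<in>words n. \<forall>y\<in>set_pmf (channel_output Adv x).
        real (count_list y None) \<le> p * real n)}"


subsection \<open>Codes and error probability\<close>

text \<open>
  For \<open>R \<le> 0\<close> the function \<^const>\<open>nat\<close> truncates the exponent to \<open>0\<close>, so there is
  exactly one message, the empty list.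
\<close>

definition messages :: "nat \<Rightarrow> real \<Rightarrow> bool list set" where
  "messages n R = words (nat \<lceil>real n * R\<rceil>)"

type_synonym encoder = "bool list \<Rightarrow> bool list pmf"
type_synonym decoder = "symbol list \<Rightarrow> bool list pmf"

definition is_code :: "nat \<Rightarrow> real \<Rightarrow> encoder \<Rightarrow> decoder \<Rightarrow> bool" where
  "is_code n R Enc Dec \<longleftrightarrow>
     (\<forall>u\<in>messages n R. set_pmf (Enc u) \<subseteq> words n) \<and>
     (\<forall>y\<in>words n. set_pmf (Dec y) \<subseteq> messages n R) \<and>
     (\<forall>u\<in>messages n R. \<forall>u'\<in>messages n R. u \<noteq> u' \<longrightarrow>
        set_pmf (Enc u) \<inter> set_pmf (Enc u') = {})"

definition P_max :: "nat \<Rightarrow> real \<Rightarrow> encoder \<Rightarrow> decoder \<Rightarrow> channel \<Rightarrow> real" where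
  "P_max n R Enc Dec Adv =
     Max ((\<lambda>u. \<Sum>x\<in>words n. pmf (Enc u) x *
                 (\<Sum>y\<in>words n. pmf (channel_output Adv x) y *
                    measure_pmf.prob (Dec y) {v. v \<noteq> u}))
          ` messages n R)"


subsection \<open>Achievability and capacity\<close>

definition achievable :: "real \<Rightarrow> real \<Rightarrow> bool" where
  "achievable p R \<longleftrightarrow> 0 \<le> R \<and>
     (\<forall>\<epsilon>>0. \<exists>Enc Dec.
        (\<forall>n\<ge>1. is_code n (R - \<epsilon>) (Enc n) (Dec n)) \<and>
        (\<forall>\<beta>>0. \<exists>n\<^sub>\<beta>. \<forall>Adv. (\<forall>n\<ge>1. Adv n \<in> CE p n) \<longrightarrow>
           (\<forall>n>n\<^sub>\<beta>. P_max n (R - \<epsilon>) (Enc n) (Dec n) (Adv n) < \<beta>)))"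

text \<open>
  For \<open>0 \<le> p\<close> the set below contains \<open>0\<close>, and by injectivity of the encoders it is bounded
  above by \<open>1\<close>, so the supremum in the reals is the intended one.
\<close>

definition capacity :: "real \<Rightarrow> real" where
  "capacity p = Sup {R. achievable p R}"


subsection \<open>The rate bound\<close>

definition H :: "real \<Rightarrow> real" where
  "H t = - t * log 2 t - (1 - t) * log 2 (1 - t)"

definition p1 :: real where
  "p1 = 3 * log 2 (4/3) / (2 + 3 * log 2 (4/3))"

definition G :: "real \<Rightarrow> real \<Rightarrow> real" where
  "G p x = (1 - x) * H ((p - x) / (1 - x)) - 1 + 2 * x"

definition r :: "real \<Rightarrow> real" where
  "r p = (THE x. x \<in> {0..3/2 * p - 1/2} \<and> G p x = 0)"

definition R_L :: "real \<Rightarrow> real" where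
  "R_L p = (if p \<le> p1 then 1 - p / log 2 (4/3)
            else if p < 1/2 then r p
            else 0)"

end

(*
  The code achieves every rate R <= 1 - 2p, which dominates R_L. The blocklength is cut into a
  constant number T of chunks, and in each chunk the encoder picks a fresh key among a constant
  number K of keys; the bits form a random array F, indexed by message, position and key of the
  chunk. The decoder outputs any message compatible with the received word. As soon as the output
  prefix shows slightly more than nR unerased symbols, only boundedly many messages are compatible
  with it (list decoding), and since R <= 1 - 2p - eps the channel can now erase less than half of
  the remaining positions. So a wrong candidate survives only if in some later chunk its codeword
  is unusually close to the sent one. For a given pair of messages this happens for few keys
  only, and by causality the keys of the later chunks are independent of the candidate list.
*)
theory Submission
  imports Defs "HOL-Real_Asymp.Real_Asymp"
begin

section \<open>The rate bound\<close>

text \<open>The rate 1 - 2p comes from a budget count. If c symbols are known after t positions, the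
  channel has spent t - c erasures. What is left of pn is below (n - t)/2 as soon as 2pn + c < n,
  because t \<ge> c. Independent random words differ in about half of the n - t remaining positions,
  so not all of these differences can be erased.

  With constantly many keys and exponentially many pairs of messages, close chunks cannot be avoided
  altogether; the array can only be asked to have fewer than \<open>m\<close> bad keys per pair and
  chunk, and lists shorter than \<open>q\<close>. Both constants occur as exponents in a union
  bound: a violation forces \<open>q * M\<close> or \<open>m * b\<close> bits of the array at once,
  which beats the number of choices once \<open>q\<close> and \<open>m\<close> are large,
  independently of n. Then \<open>K\<close> can be taken so large that \<open>q * m\<close> keys are
  a small fraction of it.

  Injectivity of the encoder is not automatic, as codewords of different messages may collide. Key
  sequences causing a collision are discarded; they are at most half of all, so the error at most
  doubles.\<close>

lemma G_eq:
  assumes "x < p" "p < 1"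
  shows "G p x = (1 - x) * log 2 (1 - x) - (p - x) * log 2 (p - x) - (1 - p) * log 2 (1 - p) - 1 + 2 * x"
proof -
  have c: "1 - (p - x) / (1 - x) = (1 - p) / (1 - x)"
    using assms by (simp add: field_simps)
  have "(1 - x) * H ((p - x) / (1 - x))
      = - (p - x) * log 2 ((p - x) / (1 - x)) - (1 - p) * log 2 ((1 - p) / (1 - x))"
  proof -
    have "w * (- (a / w) * u - (b / w) * v) = - a * u - b * v" if "w \<noteq> 0" for a b u v w :: real
      using that by (simp add: field_simps)
    moreover have "1 - x \<noteq> 0" using assms by simp
    ultimately show ?thesis unfolding H_def c .
  qed
  also have "\<dots> = - (p - x) * (log 2 (p - x) - log 2 (1 - x))
      - (1 - p) * (log 2 (1 - p) - log 2 (1 - x))"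
    using assms by (simp add: log_divide)
  also have "\<dots> = (1 - x) * log 2 (1 - x) - (p - x) * log 2 (p - x) - (1 - p) * log 2 (1 - p)"
    by (simp add: algebra_simps)
  finally show ?thesis by (simp add: G_def)
qed

lemma DERIV_mult_log_2:
  assumes "0 < x"
  shows "((\<lambda>x. x * log 2 x) has_real_derivative log 2 x + 1 / ln 2) (at x)"
  unfolding log_def using assms
  by (auto intro!: derivative_eq_intros simp: add_divide_distrib)

lemma DERIV_diff_mult_log_2:
  assumes "x < c"
  shows "((\<lambda>x. (c - x) * log 2 (c - x)) has_real_derivative - log 2 (c - x) - 1 / ln 2) (at x)"
  unfolding log_def using assms
  by (auto intro!: derivative_eq_intros simp: add_divide_distrib diff_divide_distrib)

lemma H_le_1:
  assumes "0 < p" "p < 1"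
  shows "H p \<le> 1"
proof -
  have a: "- ln (2 * p) \<le> 1 / (2 * p) - 1" "- ln (2 * (1 - p)) \<le> 1 / (2 * (1 - p)) - 1"
    using ln_le_minus_one[of "1 / (2 * p)"] ln_le_minus_one[of "1 / (2 * (1 - p))"] assms
    by (simp_all add: ln_div)
  have "- p * ln (2 * p) - (1 - p) * ln (2 * (1 - p))
      \<le> p * (1 / (2 * p) - 1) + (1 - p) * (1 / (2 * (1 - p)) - 1)"
    using mult_left_mono[OF a(1), of p] mult_left_mono[OF a(2), of "1 - p"] assms by simp
  also have "\<dots> = 0"
    using assms by (simp add: field_simps)
  also have "- p * ln (2 * p) - (1 - p) * ln (2 * (1 - p))
      = - p * (ln 2 + ln p) - (1 - p) * (ln 2 + ln (1 - p))"
    using assms by (simp only: ln_mult_pos[of 2 p] ln_mult_pos[of 2 "1 - p"])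
  finally have "- p * ln p - (1 - p) * ln (1 - p) \<le> ln 2"
    by (simp add: algebra_simps)
  moreover have "H p = (- p * ln p - (1 - p) * ln (1 - p)) / ln 2"
    by (simp add: H_def log_def diff_divide_distrib)
  ultimately show ?thesis by simp
qed

text \<open>The line has slope 1 and meets \<open>H\<close> at 1/2, while the derivative log((1 -
  s)/s) of \<open>H\<close> is at most 1 exactly from s = 1/3 on. The line is the one that makes
  \<open>G p (1 - 2 * p)\<close> nonnegative.\<close>

lemma H_ge_affine:
  assumes "1/3 \<le> s" "s \<le> 1/2"
  shows "s + 1/2 \<le> H s"
proof -
  let ?f = "\<lambda>s. H s - s - 1/2"
  have "?f (1/2) \<le> ?f s"
  proof (rule DERIV_nonpos_imp_nonincreasing[OF assms(2)])
    fix x :: real assume x: "s \<le> x" "x \<le> 1/2"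
    have x0: "0 < x" "x < 1" using x assms by auto
    have "(?f has_real_derivative (log 2 ((1 - x) / x) - 1)) (at x)"
      using DERIV_mult_log_2[OF x0(1)] DERIV_diff_mult_log_2[OF x0(2)] x0
      unfolding H_def by (auto intro!: derivative_eq_intros simp: log_divide)
    moreover have "log 2 ((1 - x) / x) \<le> log 2 2"
      using x0 x assms by (intro log_mono) (auto simp: field_simps)
    ultimately show "\<exists>y. (?f has_real_derivative y) (at x) \<and> y \<le> 0" by auto
  qed
  moreover have "H (1/2) = 1"
    by (simp add: H_def log_divide)
  ultimately show ?thesis by simp
qed

text \<open>The derivative log((p - x)/(1 - x)) + 2 is positive while the quotient exceeds 1/4. The
  quotient decreases in x and still equals 1/3 at the right endpoint.\<close>

lemma G_strict_mono:
  assumes p: "p < 1" and "x < y" "y \<le> 3/2 * p - 1/2"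
  shows "G p x < G p y"
proof -
  let ?g = "\<lambda>x. (1 - x) * log 2 (1 - x) - (p - x) * log 2 (p - x) - (1 - p) * log 2 (1 - p) - 1 + 2 * x"
  have "?g x < ?g y"
  proof (rule DERIV_pos_imp_increasing[OF \<open>x < y\<close>])
    fix z assume z: "x \<le> z" "z \<le> y"
    have z1: "z < p" "z < 1" using z assms by auto
    have "(?g has_real_derivative (log 2 ((p - z) / (1 - z)) + 2)) (at z)"
      using DERIV_diff_mult_log_2[OF z1(1)] DERIV_diff_mult_log_2[OF z1(2)] z1
      by (auto intro!: derivative_eq_intros simp: log_divide)
    moreover have "log 2 (1/4) < log 2 ((p - z) / (1 - z))"
      using z1 z assms by (subst log_less_cancel_iff) (auto simp: field_simps)
    moreover have "log 2 (1/4) = (-2 :: real)"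
      using log_pow_cancel[of "2::real" 2] by (simp add: log_divide)
    ultimately show "\<exists>y. (?g has_real_derivative y) (at z) \<and> y > 0"
      by (intro exI[of _ "log 2 ((p - z) / (1 - z)) + 2"]) auto
  qed
  then show ?thesis using assms by (simp add: G_eq)
qed

lemma log_4_3: "log 2 (4/3 :: real) = 2 - log 2 3"
  using log_pow_cancel[of "2::real" 2] by (simp add: log_divide)

lemma log_4_3_bounds: "1/3 \<le> log 2 (4/3 :: real)" "log 2 (4/3 :: real) \<le> 1/2"
proof -
  have "log 2 2 \<le> log 2 ((4/3 :: real) ^ 3)"
    by (subst log_le_cancel_iff) (auto simp: power_divide)
  then show "1/3 \<le> log 2 (4/3 :: real)" by (subst (asm) log_nat_power) auto
  have "log 2 ((4/3 :: real) ^ 2) \<le> log 2 2"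
    by (subst log_le_cancel_iff) (auto simp: power_divide)
  then show "log 2 (4/3 :: real) \<le> 1/2" by (subst (asm) log_nat_power) auto
qed

text \<open>The bound 1/3 makes the interval in \<open>r\<close> nonempty beyond \<open>p1\<close>,
  and the bound by \<open>log 2 (4/3)\<close> keeps the first branch of \<open>R_L\<close>
  nonnegative.\<close>

lemma p1_bounds: "1/3 \<le> p1" "p1 \<le> log 2 (4/3)" "p1 < 1/2"
  using log_4_3_bounds unfolding p1_def by (auto simp: field_simps)

text \<open>Here the arguments of the logarithms are 3d, d and 2d with d = (1 - p)/2, so log d
  cancels and an affine function of p remains. Its zero is \<open>p1\<close>, which is where that
  constant comes from.\<close>

lemma G_right_endpoint:
  assumes "p < 1"
  shows "G p (3/2 * p - 1/2) = p * (1 + 3/2 * log 2 (4/3)) - 3/2 * log 2 (4/3)"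
proof -
  define d where "d = (1 - p) / 2"
  have e: "1 - (3/2 * p - 1/2) = 3 * d" "p - (3/2 * p - 1/2) = d" "1 - p = 2 * d" "p = 1 - 2 * d"
    by (simp_all add: d_def field_simps)
  have "d > 0" using assms by (simp add: d_def)
  have "G p (3/2 * p - 1/2) = 3 * d * log 2 (3 * d) - d * log 2 d - 2 * d * log 2 (2 * d)
      - 1 + 2 * (3/2 * p - 1/2)"
    using G_eq[of "3/2 * p - 1/2" p] assms unfolding e(1-3) by simp
  also have "\<dots> = 3 * d * (log 2 3 + log 2 d) - d * log 2 d - 2 * d * (1 + log 2 d) + 1 - 6 * d"
    using \<open>d > 0\<close> by (simp add: log_mult_pos) (simp add: e(4))
  also have "\<dots> = p * (1 + 3/2 * log 2 (4/3)) - 3/2 * log 2 (4/3)"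
    unfolding log_4_3 by (subst e(4)) (simp add: field_simps)
  finally show ?thesis .
qed

lemma G_root_ex1:
  assumes "p1 < p" "p < 1/2"
  shows "\<exists>!x. x \<in> {0..3/2 * p - 1/2} \<and> G p x = 0"
proof -
  have p: "1/3 < p" "p < 1" using assms p1_bounds by auto
  let ?g = "\<lambda>x. (1 - x) * log 2 (1 - x) - (p - x) * log 2 (p - x) - (1 - p) * log 2 (1 - p) - 1 + 2 * x"
  have "continuous_on {0..3/2 * p - 1/2} ?g"
    using p assms by (intro continuous_intros) auto
  then have cont: "continuous_on {0..3/2 * p - 1/2} (G p)"
    using p assms by (subst continuous_on_cong[OF refl G_eq]) auto
  have "G p 0 \<le> 0" using H_le_1[of p] p by (simp add: G_def)
  moreover have "G p (3/2 * p - 1/2) \<ge> 0"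
    using assms log_4_3_bounds unfolding G_right_endpoint[OF p(2)] p1_def
    by (simp add: field_simps)
  ultimately obtain x where x: "x \<in> {0..3/2 * p - 1/2}" "G p x = 0"
    using IVT'[of "G p" 0 0 "3/2 * p - 1/2"] cont p by auto
  show ?thesis
  proof (rule ex1I[of _ x])
    fix y assume y: "y \<in> {0..3/2 * p - 1/2} \<and> G p y = 0"
    show "y = x"
      using G_strict_mono[OF p(2), of x y] G_strict_mono[OF p(2), of y x] x y
      by (cases x y rule: linorder_cases) auto
  qed (use x in auto)
qed

text \<open>By monotonicity, a root beyond 1 - 2p would make \<open>G p\<close> negative at 1 -
  2p.\<close>

lemma r_bounds:
  assumes "p1 < p" "p < 1/2"
  shows "0 \<le> r p" "r p \<le> 1 - 2 * p"
proof -
  have p: "1/3 < p" "p < 1" using assms p1_bounds by auto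
  have r: "r p \<in> {0..3/2 * p - 1/2}" "G p (r p) = 0"
    using theI'[OF G_root_ex1[OF assms]] unfolding r_def by auto
  then show "0 \<le> r p" by simp
  show "r p \<le> 1 - 2 * p"
  proof (rule ccontr)
    assume "\<not> ?thesis"
    then have less: "1 - 2 * p < r p" by simp
    then have "G p (1 - 2 * p) < 0"
      using G_strict_mono[OF p(2) less] r by auto
    \<comment> \<open>This is the entropy argument of \<open>G p (1 - 2 * p)\<close>. It is at least
      1/3 because 1 - 2p < \<open>r p\<close> \<le> 3p/2 - 1/2 forces p > 3/7.\<close>
    moreover have "(3 * p - 1) / (2 * p) + 1/2 \<le> H ((3 * p - 1) / (2 * p))"
      using less r p assms by (intro H_ge_affine) (auto simp: field_simps)
    then have "2 * p * ((3 * p - 1) / (2 * p) + 1/2) \<le> 2 * p * H ((3 * p - 1) / (2 * p))"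
      using p by (intro mult_left_mono) auto
    moreover have "2 * p * ((3 * p - 1) / (2 * p) + 1/2) = 4 * p - 1"
      using p by (simp add: field_simps)
    moreover have "G p (1 - 2 * p) = 2 * p * H ((3 * p - 1) / (2 * p)) + 1 - 4 * p"
      using p by (simp add: G_def)
    ultimately show False by linarith
  qed
qed

lemma R_L_bounds:
  assumes "0 \<le> p"
  shows "0 \<le> R_L p" "p < 1/2 \<Longrightarrow> R_L p \<le> 1 - 2 * p" "1/2 \<le> p \<Longrightarrow> R_L p = 0"
proof -
  have a: "p \<le> p1 \<Longrightarrow> p / log 2 (4/3) \<le> 1"
    using p1_bounds log_4_3_bounds by (simp add: field_simps)
  show "0 \<le> R_L p"
    using a r_bounds[of p] by (auto simp: R_L_def)
  have "2 * p \<le> p / log 2 (4/3)"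
    using log_4_3_bounds assms mult_left_mono[of "log 2 (4/3 :: real)" "1/2" p]
    by (simp add: field_simps)
  then show "p < 1/2 \<Longrightarrow> R_L p \<le> 1 - 2 * p"
    using r_bounds[of p] by (auto simp: R_L_def)
  show "1/2 \<le> p \<Longrightarrow> R_L p = 0"
    using p1_bounds by (auto simp: R_L_def)
qed

section \<open>Error analysis of chunked codes\<close>

definition agrees :: "symbol list \<Rightarrow> bool list \<Rightarrow> bool" where
  "agrees y x \<longleftrightarrow> (\<forall>i<length x. y ! i = None \<or> y ! i = Some (x ! i))"

definition known :: "symbol list \<Rightarrow> nat set" where
  "known z = {i. i < length z \<and> z ! i \<noteq> None}"

section \<open>Laws of output prefixes\<close>

lemma length_output_prefix:
  "ys \<in> set_pmf (output_prefix Adv x t) \<Longrightarrow> length ys = t"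
  by (induction t arbitrary: ys) auto

text \<open>Together with \<open>map_take_output_prefix\<close> this makes the law of the first t
  outputs independent of all later inputs, which is how causality enters the error bound.\<close>

lemma output_prefix_cong:
  "take t x = take t x' \<Longrightarrow> output_prefix Adv x t = output_prefix Adv x' t"
proof (induction t)
  case (Suc t)
  have "take t x = take t x'"
    using arg_cong[OF Suc.prems, of "take t"] by (simp add: min_def)
  then show ?case using Suc by simp
qed simp

lemma map_take_output_prefix:
  "t \<le> n \<Longrightarrow> map_pmf (take t) (output_prefix Adv x n) = output_prefix Adv x t"
proof (induction n)
  case (Suc n)
  show ?case
  proof (cases "t = Suc n")
    case True
    have "map_pmf (take t) (output_prefix Adv x t) = map_pmf (\<lambda>y. y) (output_prefix Adv x t)"
      by (rule map_pmf_cong) (auto dest: length_output_prefix)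
    then show ?thesis using True by simp
  next
    case False
    then have t: "t \<le> n" using Suc.prems by simp
    have "map_pmf (take t) (output_prefix Adv x (Suc n))
        = bind_pmf (output_prefix Adv x n)
            (\<lambda>ys. map_pmf (\<lambda>y. take t (ys @ [y])) (Adv (take (Suc n) x) ys))"
      by (simp add: map_bind_pmf pmf.map_comp o_def)
    also have "\<dots> = bind_pmf (output_prefix Adv x n) (\<lambda>ys. return_pmf (take t ys))"
      using t by (intro bind_pmf_cong refl) (auto dest!: length_output_prefix)
    also have "\<dots> = map_pmf (take t) (output_prefix Adv x n)"
      by (simp add: map_pmf_def)
    finally show ?thesis using Suc.IH t by simp
  qed
qed (simp add: bind_return_pmf)

lemma channel_output_support:
  assumes Adv: "Adv \<in> CE p n" and x: "length x = n" and y: "y \<in> set_pmf (channel_output Adv x)"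
  shows "length y = n" "real (count_list y None) \<le> p * real n" "agrees y x"
proof -
  show "length y = n" using y x by (auto simp: channel_output_def dest: length_output_prefix)
  show "real (count_list y None) \<le> p * real n"
    using Adv x y by (auto simp: CE_def words_def)
  have "\<forall>i<t. ys ! i = None \<or> ys ! i = Some (x ! i)"
    if "t \<le> n" "ys \<in> set_pmf (output_prefix Adv x t)" for t ys
    using that
  proof (induction t arbitrary: ys)
    case (Suc t)
    from Suc.prems obtain zs y where ys: "ys = zs @ [y]" "zs \<in> set_pmf (output_prefix Adv x t)"
      "y \<in> set_pmf (Adv (take (Suc t) x) zs)"
      by auto
    have len: "length zs = t" using ys length_output_prefix by blast
    have "set_pmf (Adv (take (Suc t) x) zs) \<subseteq> {Some (last (take (Suc t) x)), None}"
    proof -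
      have "Suc t \<in> {1..n}" "take (Suc t) x \<in> words (Suc t)" "zs \<in> words (Suc t - 1)"
        using Suc.prems x len by (auto simp: words_def)
      then show ?thesis using Adv unfolding CE_def by blast
    qed
    moreover have "last (take (Suc t) x) = x ! t"
      using Suc.prems x by (simp add: take_Suc_conv_app_nth)
    ultimately have "y = None \<or> y = Some (x ! t)" using ys(3) by auto
    then show ?case using Suc.IH[of zs] Suc.prems ys len
      by (auto simp: nth_append less_Suc_eq)
  qed simp
  then show "agrees y x" using y x by (auto simp: agrees_def channel_output_def)
qed

text \<open>Double counting: the sum is moved inside the expectation. The law \<open>Z\<close> is
  the same for all s, so this bounds the chance that a uniform key, independent of z, is among the
  few keys that z singles out.\<close>

lemma sum_prob_le:
  assumes "finite S" "\<And>z. card {s\<in>S. Q s z} \<le> w"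
  shows "(\<Sum>s\<in>S. measure_pmf.prob Z {z. Q s z}) \<le> real w"
proof -
  have "(\<Sum>s\<in>S. measure_pmf.prob Z {z. Q s z})
      = (\<Sum>s\<in>S. measure_pmf.expectation Z (indicator {z. Q s z}))"
    by simp
  also have "\<dots> = measure_pmf.expectation Z (\<lambda>z. \<Sum>s\<in>S. indicator {z. Q s z} z)"
    by (subst Bochner_Integration.integral_sum) (auto intro!: measure_pmf.integrable_const_bound[of _ 1])
  also have "\<dots> = measure_pmf.expectation Z (\<lambda>z. real (card {s\<in>S. Q s z}))"
    using assms(1) by (intro Bochner_Integration.integral_cong refl)
      (simp add: indicator_def sum.If_cases Int_def)
  also have "\<dots> \<le> measure_pmf.expectation Z (\<lambda>z. real w)"
    using assms by (intro integral_mono measure_pmf.integrable_const_bound[of _ "real w"]) auto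
  finally show ?thesis by simp
qed

text \<open>\<open>T\<close> chunks of length \<open>b\<close> cover the block; positions from
  \<open>n\<close> to \<open>T * b\<close> are padding and count as erased in the erasure bound
  \<open>B\<close>. Once \<open>M\<close> symbols are known, fewer than \<open>q\<close> candidates
  remain, and chunk words at distance at most \<open>a\<close> count as close. In
  \<open>slack\<close>, j is the first number of completed chunks after which \<open>M\<close>
  symbols are known. Fewer than \<open>M + b\<close> are known then, so more than
  \<open>j * b - M - b\<close> erasures are spent, and the rest cannot cover \<open>a + 1\<close>
  positions in each of the \<open>T - j\<close> later chunks.\<close>

locale chunk_code =
  fixes n b T K :: nat and Msgs :: "'u set" and F :: "('u \<times> nat \<times> nat) set"
    and M q a m B :: nat
  assumes b_pos: "0 < b" and n_le: "n \<le> T * b" and finite_Msgs: "finite Msgs"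
    and M_pos: "0 < M" and M_le: "M \<le> T * b"
    and slack: "\<And>j. j \<le> T \<Longrightarrow> M \<le> j * b \<Longrightarrow> B + M + b \<le> j * b + (T - j) * (a + 1)"
    and short_lists: "\<And>P v. P \<subseteq> {..<n} \<Longrightarrow> v \<subseteq> P \<Longrightarrow> M \<le> card P \<Longrightarrow>
      card {u\<in>Msgs. \<exists>k\<in>PiE {..<T} (\<lambda>_. {..<K}). \<forall>i\<in>P. (u, i, k (i div b)) \<in> F \<longleftrightarrow> i \<in> v} < q"
    and few_bad_keys: "\<And>u u' i. u \<in> Msgs \<Longrightarrow> u' \<in> Msgs \<Longrightarrow> u \<noteq> u' \<Longrightarrow> i < T \<Longrightarrow>
      card {\<kappa>\<in>{..<K}. \<exists>\<kappa>'<K. card {s\<in>{i*b..<i*b+b}. ((u, s, \<kappa>) \<in> F) \<noteq> ((u', s, \<kappa>') \<in> F)} \<le> a} < m"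
begin

section \<open>Candidate lists and risky keys\<close>

definition keys :: "(nat \<Rightarrow> nat) set" where
  "keys = PiE {..<T} (\<lambda>_. {..<K})"

definition codeword :: "'u \<Rightarrow> (nat \<Rightarrow> nat) \<Rightarrow> bool list" where
  "codeword u k = map (\<lambda>i. (u, i, k (i div b)) \<in> F) [0..<n]"

definition confusable :: "'u \<Rightarrow> symbol list \<Rightarrow> bool" where
  "confusable u y \<longleftrightarrow> (\<exists>u'\<in>Msgs - {u}. \<exists>k\<in>keys. agrees y (codeword u' k))"

definition differ :: "'u \<Rightarrow> nat \<Rightarrow> 'u \<Rightarrow> nat \<Rightarrow> nat \<Rightarrow> nat set" where
  "differ u \<kappa> u' \<kappa>' i = {s\<in>{i*b..<i*b+b}. ((u, s, \<kappa>) \<in> F) \<noteq> ((u', s, \<kappa>') \<in> F)}"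

definition bad_keys :: "'u \<Rightarrow> 'u \<Rightarrow> nat \<Rightarrow> nat set" where
  "bad_keys u u' i = {\<kappa>\<in>{..<K}. \<exists>\<kappa>'<K. card (differ u \<kappa> u' \<kappa>' i) \<le> a}"

definition candidates :: "symbol list \<Rightarrow> 'u set" where
  "candidates z = {u\<in>Msgs. \<exists>k\<in>keys. \<forall>i\<in>known z. (u, i, k (i div b)) \<in> F \<longleftrightarrow> z ! i = Some True}"

text \<open>With fewer than \<open>M\<close> known symbols the candidate list may be huge; the empty
  default keeps the bound \<open>q * m\<close> valid for every prefix.\<close>

definition risky :: "'u \<Rightarrow> symbol list \<Rightarrow> nat \<Rightarrow> nat set" where
  "risky u z i = (if M \<le> card (known z) then \<Union>u'\<in>candidates z - {u}. bad_keys u u' i else {})"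

lemma length_codeword [simp]: "length (codeword u k) = n"
  by (simp add: codeword_def)

lemma nth_codeword: "i < n \<Longrightarrow> codeword u k ! i \<longleftrightarrow> (u, i, k (i div b)) \<in> F"
  by (simp add: codeword_def)

lemma finite_keys: "finite keys"
  by (simp add: keys_def finite_PiE)

lemma card_keys: "card keys = K ^ T"
  by (simp add: keys_def card_PiE)

lemma card_risky_le:
  assumes "u \<in> Msgs" "i < T" "length z \<le> n"
  shows "card (risky u z i) \<le> q * m"
proof (cases "M \<le> card (known z)")
  case True
  have "card (candidates z) < q"
  proof -
    have "candidates z = {u\<in>Msgs. \<exists>k\<in>PiE {..<T} (\<lambda>_. {..<K}).
        \<forall>i\<in>known z. (u, i, k (i div b)) \<in> F \<longleftrightarrow> i \<in> {i\<in>known z. z ! i = Some True}}"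
      by (auto simp: candidates_def keys_def)
    also have "card \<dots> < q"
      using True assms by (intro short_lists) (auto simp: known_def)
    finally show ?thesis .
  qed
  moreover have fin: "finite (candidates z)" using finite_Msgs by (simp add: candidates_def)
  ultimately have c: "card (candidates z - {u}) \<le> q"
    using card_Diff1_le[of "candidates z" u] by linarith
  have "card (risky u z i) \<le> (\<Sum>u'\<in>candidates z - {u}. card (bad_keys u u' i))"
    using True fin by (simp add: risky_def card_UN_le)
  also have "\<dots> \<le> (\<Sum>u'\<in>candidates z - {u}. m)"
    using assms few_bad_keys[of u]
    by (intro sum_mono less_imp_le) (auto simp: bad_keys_def differ_def candidates_def)
  also have "\<dots> \<le> q * m" using c by simp
  finally show ?thesis .
qed (simp add: risky_def)

text \<open>Let j be the first chunk boundary with \<open>M\<close> known symbols. Two codewords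
  compatible with \<open>y\<close> differ only at erased positions. Were they more than
  \<open>a\<close> apart in every chunk from j on, this would cost more erasures than
  \<open>slack\<close> leaves. Hence some later chunk is close, and the other message is already a
  candidate at boundary j.\<close>

lemma confusable_imp_risky:
  assumes k: "k \<in> keys" and y: "length y = n" "agrees y (codeword u k)"
    and few: "count_list y None + (T * b - n) \<le> B" and conf: "confusable u y"
  shows "\<exists>j<T. \<exists>i\<in>{j..<T}. k i \<in> risky u (take (j * b) y) i"
proof -
  obtain u' k' where u': "u' \<in> Msgs" "u' \<noteq> u" "k' \<in> keys" "agrees y (codeword u' k')"
    using conf by (auto simp: confusable_def)
  define E where "E = {s\<in>{..<T * b}. s \<notin> known y}"
  define c where "c j = card (known (take (j * b) y))" for j
  have known_take: "known (take t y) = known y \<inter> {..<t}" for t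
    by (auto simp: known_def)
  have known_sub: "known y \<subseteq> {..<n}" using y by (auto simp: known_def)
  have fin: "finite (known y)" using known_sub finite_subset by blast
  have c_eq: "c j + card (E \<inter> {..<j * b}) = j * b" if "j \<le> T" for j
  proof -
    have "j * b \<le> T * b" using that by simp
    then have "{..<j * b} = (known y \<inter> {..<j * b}) \<union> (E \<inter> {..<j * b})"
      by (auto simp: E_def intro: less_le_trans)
    then have "card {..<j * b} = card (known y \<inter> {..<j * b}) + card (E \<inter> {..<j * b})"
      using fin by (subst card_Un_disjoint[symmetric]) (auto simp: E_def)
    then show ?thesis by (simp add: c_def known_take)
  qed
  have "card E \<le> card ({i. i < n \<and> y ! i = None} \<union> {n..<T * b})"
    by (rule card_mono) (auto simp: E_def known_def y)
  also have "\<dots> \<le> card {i. i < n \<and> y ! i = None} + (T * b - n)"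
    using card_Un_le[of "{i. i < n \<and> y ! i = None}" "{n..<T * b}"] by simp
  also have "card {i. i < n \<and> y ! i = None} = count_list y None"
    using y by (simp add: count_list_eq_length_filter length_filter_conv_card eq_commute)
  finally have E_le: "card E \<le> B" using few by simp
  have finE: "finite E" by (simp add: E_def)
  \<comment> \<open>At j = \<open>T\<close>, \<open>slack\<close> says that \<open>M + b\<close>
    positions remain even if all \<open>B\<close> erasures are spent, so the boundary j
    exists.\<close>
  have "M \<le> c T"
  proof -
    have "card (E \<inter> {..<T * b}) \<le> card E" using finE by (intro card_mono) auto
    then show ?thesis using c_eq[of T] slack[of T] E_le M_le by simp
  qed
  define j where "j = (LEAST j. M \<le> c j)"
  have cj: "M \<le> c j" using \<open>M \<le> c T\<close> unfolding j_def by (rule LeastI)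
  have "j \<le> T" using \<open>M \<le> c T\<close> unfolding j_def by (rule Least_le)
  have "c 0 = 0" by (simp add: c_def known_def)
  then have "j \<noteq> 0" using cj M_pos by (metis less_le_not_le)
  then obtain j' where j': "j = Suc j'" using not0_implies_Suc by blast
  have "c j' < M" using not_less_Least[of j' "\<lambda>j. M \<le> c j"] j' by (simp add: j_def)
  \<comment> \<open>An upper bound on the known symbols is a lower bound on the erasures already
    spent; overshooting \<open>M\<close> costs at most one chunk.\<close>
  have "c j \<le> c j' + b"
  proof -
    have "c j \<le> card ((known y \<inter> {..<j' * b}) \<union> {j' * b..<j * b})"
      unfolding c_def known_take using fin by (intro card_mono) auto
    also have "\<dots> \<le> c j' + card {j' * b..<j * b}"
      unfolding c_def known_take by (rule card_Un_le)
    finally show ?thesis by (simp add: j')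
  qed
  then have cj_less: "c j < M + b" using \<open>c j' < M\<close> by simp
  have "M \<le> j * b" using cj c_eq[OF \<open>j \<le> T\<close>] by simp
  then have rest: "B + M + b \<le> j * b + (T - j) * (a + 1)" using slack \<open>j \<le> T\<close> by blast
  have "card E = card (E \<inter> {..<j * b}) + card (E - {..<j * b})"
    using finE by (subst card_Un_disjoint[symmetric]) (auto intro!: arg_cong[of _ _ card])
  \<comment> \<open>This also excludes j = \<open>T\<close>, where the right-hand side is 0.\<close>
  then have tail: "card (E - {..<j * b}) < (T - j) * (a + 1)"
    using c_eq[OF \<open>j \<le> T\<close>] cj_less rest E_le by linarith
  have "\<exists>i\<in>{j..<T}. card (differ u (k i) u' (k' i) i) \<le> a"
  proof (rule ccontr)
    assume "\<not> ?thesis"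
    then have far: "a + 1 \<le> card (differ u (k i) u' (k' i) i)" if "i \<in> {j..<T}" for i
      using that by force
    have chunk: "s div b = i" if "s \<in> differ u \<kappa> u' \<kappa>' i" for s \<kappa> \<kappa>' i
      using that b_pos by (auto simp: differ_def intro!: div_nat_eqI simp: algebra_simps)
    have "(T - j) * (a + 1) = (\<Sum>i\<in>{j..<T}. a + 1)" by simp
    also have "\<dots> \<le> (\<Sum>i\<in>{j..<T}. card (differ u (k i) u' (k' i) i))"
      using far by (intro sum_mono)
    also have "\<dots> = card (\<Union>i\<in>{j..<T}. differ u (k i) u' (k' i) i)"
    proof (rule card_UN_disjoint[symmetric])
      show "\<forall>i\<in>{j..<T}. \<forall>i'\<in>{j..<T}. i \<noteq> i' \<longrightarrow>
          differ u (k i) u' (k' i) i \<inter> differ u (k i') u' (k' i') i' = {}"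
        using chunk by blast
    qed (auto simp: differ_def)
    also have "\<dots> \<le> card (E - {..<j * b})"
    proof (rule card_mono)
      show "(\<Union>i\<in>{j..<T}. differ u (k i) u' (k' i) i) \<subseteq> E - {..<j * b}"
      proof
        fix s assume "s \<in> (\<Union>i\<in>{j..<T}. differ u (k i) u' (k' i) i)"
        then obtain i where i: "i \<in> {j..<T}" and s: "s \<in> differ u (k i) u' (k' i) i" by blast
        have "i * b + b \<le> T * b" using i by (metis Suc_leI add.commute atLeastLessThan_iff mult_Suc mult_le_mono1)
        moreover have sb: "i * b \<le> s" "s < i * b + b" using s by (auto simp: differ_def)
        moreover have "j * b \<le> s" using i by (intro le_trans[OF mult_le_mono1 sb(1)]) simp
        moreover have "s \<notin> known y"
        proof
          assume "s \<in> known y"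
          then have "s < n" "y ! s \<noteq> None" using y by (auto simp: known_def)
          then have "codeword u k ! s = codeword u' k' ! s"
            using y(2) u'(4) unfolding agrees_def length_codeword by (metis option.inject)
          then show False using \<open>s < n\<close> s chunk[OF s] by (auto simp: differ_def nth_codeword)
        qed
        ultimately show "s \<in> E - {..<j * b}" by (auto simp: E_def)
      qed
    qed (use finE in simp)
    finally show False using tail by simp
  qed
  then obtain i where i: "i \<in> {j..<T}" "card (differ u (k i) u' (k' i) i) \<le> a" by blast
  have "u' \<in> candidates (take (j * b) y)"
  proof -
    have "(u', s, k' (s div b)) \<in> F \<longleftrightarrow> take (j * b) y ! s = Some True"
      if "s \<in> known (take (j * b) y)" for s
    proof -
      have "s < n" "y ! s \<noteq> None" "s < j * b" using that known_sub y by (auto simp: known_def)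
      moreover have "y ! s = Some (codeword u' k' ! s)"
        using u'(4) calculation by (auto simp: agrees_def)
      ultimately show ?thesis by (simp add: nth_codeword)
    qed
    then show ?thesis using u' by (auto simp: candidates_def)
  qed
  moreover have "k i \<in> bad_keys u u' i"
    using i k u'(3) by (auto simp: bad_keys_def keys_def PiE_def Pi_def)
  ultimately have "k i \<in> risky u (take (j * b) y) i"
    using cj u'(2) by (auto simp: risky_def c_def)
  then show ?thesis using i by (intro exI[of _ j] conjI bexI[of _ i]) auto
qed

text \<open>As j \<le> i, the first j chunks do not use the key of chunk i, so the law of the output
  prefix does not depend on it. With the other \<open>T - 1\<close> keys fixed,
  \<open>sum_prob_le\<close> applies to this single key.\<close>

lemma sum_prob_risky:
  assumes u: "u \<in> Msgs" and i: "i < T" and j: "j \<le> i"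
  shows "(\<Sum>k\<in>keys. measure_pmf.prob (channel_output Adv (codeword u k))
      {y. k i \<in> risky u (take (j * b) y) i}) \<le> real (K ^ (T - 1) * (q * m))"
proof -
  \<comment> \<open>The last chunk may stick out beyond \<open>n\<close>, where there is no
    output.\<close>
  define t where "t = min n (j * b)"
  define I where "I = {..<T} - {i}"
  define g where "g k = output_prefix Adv (codeword u k) t" for k
  \<comment> \<open>The condition on the length of z holds almost surely. It is recorded because
    \<open>card_risky_le\<close> needs it and \<open>sum_prob_le\<close> asks for a bound at every
    z.\<close>
  have prob_eq: "measure_pmf.prob (channel_output Adv (codeword u k))
      {y. \<kappa> \<in> risky u (take (j * b) y) i} = measure_pmf.prob (g k) {z. length z \<le> n \<and> \<kappa> \<in> risky u z i}"
    for k \<kappa>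
  proof -
    have "measure_pmf.prob (g k) {z. length z \<le> n \<and> \<kappa> \<in> risky u z i}
        = measure_pmf.prob (map_pmf (take t) (output_prefix Adv (codeword u k) n))
            {z. length z \<le> n \<and> \<kappa> \<in> risky u z i}"
      unfolding g_def by (subst map_take_output_prefix) (auto simp: t_def)
    also have "\<dots> = measure_pmf.prob (channel_output Adv (codeword u k))
        {y. length (take t y) \<le> n \<and> \<kappa> \<in> risky u (take t y) i}"
      by (simp add: channel_output_def vimage_def)
    also have "\<dots> = measure_pmf.prob (channel_output Adv (codeword u k))
        {y. \<kappa> \<in> risky u (take (j * b) y) i}"
    proof (rule measure_pmf.finite_measure_eq_AE)
      show "AE y in measure_pmf (channel_output Adv (codeword u k)).
          (y \<in> {y. length (take t y) \<le> n \<and> \<kappa> \<in> risky u (take t y) i}) =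
          (y \<in> {y. \<kappa> \<in> risky u (take (j * b) y) i})"
      proof (rule AE_pmfI)
        fix y assume "y \<in> set_pmf (channel_output Adv (codeword u k))"
        then have "length y = n" by (auto simp: channel_output_def dest: length_output_prefix)
        then have "take t y = take (j * b) y" by (simp add: t_def min_def)
        then show "(y \<in> {y. length (take t y) \<le> n \<and> \<kappa> \<in> risky u (take t y) i}) =
          (y \<in> {y. \<kappa> \<in> risky u (take (j * b) y) i})" using \<open>length y = n\<close> by simp
      qed
    qed auto
    finally show ?thesis by simp
  qed
  have causal: "g (k(i := \<kappa>)) = g k" for k \<kappa>
  proof -
    have "s div b \<noteq> i" if "s < j * b" for s
      using less_mult_imp_div_less[OF that] j by simp
    then have "take t (codeword u (k(i := \<kappa>))) = take t (codeword u k)"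
      by (auto simp: codeword_def take_map t_def)
    then show ?thesis unfolding g_def by (rule output_prefix_cong)
  qed
  have keys_eq: "keys = (\<lambda>(\<kappa>, k). k(i := \<kappa>)) ` ({..<K} \<times> PiE I (\<lambda>_. {..<K}))"
    using PiE_insert_eq[of i I "\<lambda>_. {..<K}"] i by (simp add: keys_def I_def insert_absorb)
  have inj: "inj_on (\<lambda>(\<kappa>, k). k(i := \<kappa>)) ({..<K} \<times> PiE I (\<lambda>_. {..<K}))"
    using inj_combinator[of i I "\<lambda>_. {..<K}"] by (simp add: I_def)
  have "(\<Sum>k\<in>keys. measure_pmf.prob (channel_output Adv (codeword u k))
        {y. k i \<in> risky u (take (j * b) y) i})
      = (\<Sum>(\<kappa>, k)\<in>{..<K} \<times> PiE I (\<lambda>_. {..<K}). measure_pmf.prob (g k) {z. length z \<le> n \<and> \<kappa> \<in> risky u z i})"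
    unfolding prob_eq keys_eq sum.reindex[OF inj] by (simp add: case_prod_unfold causal o_def)
  also have "\<dots> = (\<Sum>k\<in>PiE I (\<lambda>_. {..<K}). \<Sum>\<kappa><K. measure_pmf.prob (g k) {z. length z \<le> n \<and> \<kappa> \<in> risky u z i})"
    by (subst sum.cartesian_product[symmetric]) (rule sum.swap)
  also have "\<dots> \<le> (\<Sum>k\<in>PiE I (\<lambda>_. {..<K}). real (q * m))"
  proof (intro sum_mono sum_prob_le)
    fix z
    show "card {\<kappa>\<in>{..<K}. length z \<le> n \<and> \<kappa> \<in> risky u z i} \<le> q * m"
    proof (cases "length z \<le> n")
      case True
      have "finite (risky u z i)"
        using finite_Msgs by (auto simp: risky_def candidates_def bad_keys_def)
      then have "card {\<kappa>\<in>{..<K}. length z \<le> n \<and> \<kappa> \<in> risky u z i} \<le> card (risky u z i)"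
        by (intro card_mono) auto
      then show ?thesis using card_risky_le[OF u i True] by simp
    qed simp
  qed simp
  also have "\<dots> = real (K ^ (T - 1) * (q * m))"
    using i by (simp add: card_PiE I_def)
  finally show ?thesis .
qed

lemma sum_prob_confusable:
  assumes u: "u \<in> Msgs" and Adv: "Adv \<in> CE p n" and B: "p * real n + real (T * b - n) < real B + 1"
  shows "(\<Sum>k\<in>keys. measure_pmf.prob (channel_output Adv (codeword u k)) {y. confusable u y})
      \<le> real (T * T * (K ^ (T - 1) * (q * m)))"
proof -
  define J where "J = (SIGMA j:{..<T}. {j..<T})"
  have finJ: "finite J" by (simp add: J_def)
  have cardJ: "card J \<le> T * T"
  proof -
    have "card J \<le> card ({..<T} \<times> {..<T})" by (rule card_mono) (auto simp: J_def)
    then show ?thesis by simp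
  qed
  have "measure_pmf.prob (channel_output Adv (codeword u k)) {y. confusable u y}
      \<le> (\<Sum>(j, i)\<in>J. measure_pmf.prob (channel_output Adv (codeword u k))
          {y. k i \<in> risky u (take (j * b) y) i})" if k: "k \<in> keys" for k
  proof -
    have "measure_pmf.prob (channel_output Adv (codeword u k)) {y. confusable u y}
        \<le> measure_pmf.prob (channel_output Adv (codeword u k))
            (\<Union>ji\<in>J. {y. k (snd ji) \<in> risky u (take (fst ji * b) y) (snd ji)})"
    proof (rule measure_pmf.finite_measure_mono_AE)
      show "AE y in measure_pmf (channel_output Adv (codeword u k)). y \<in> {y. confusable u y} \<longrightarrow>
          y \<in> (\<Union>ji\<in>J. {y. k (snd ji) \<in> risky u (take (fst ji * b) y) (snd ji)})"
      proof (intro AE_pmfI impI)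
        fix y assume y: "y \<in> set_pmf (channel_output Adv (codeword u k))" "y \<in> {y. confusable u y}"
        note supp = channel_output_support[OF Adv length_codeword y(1)]
        \<comment> \<open>Integrality turns this strict real bound into a bound by
          \<open>B\<close>.\<close>
        have "real (count_list y None + (T * b - n)) < real B + 1" using supp(2) B by simp
        then have "count_list y None + (T * b - n) \<le> B" by linarith
        then obtain j i where "j < T" "i \<in> {j..<T}" "k i \<in> risky u (take (j * b) y) i"
          using confusable_imp_risky[OF k supp(1,3)] y by blast
        then show "y \<in> (\<Union>ji\<in>J. {y. k (snd ji) \<in> risky u (take (fst ji * b) y) (snd ji)})"
          by (intro UN_I[of "(j, i)"]) (auto simp: J_def)
      qed
    qed simp
    also have "\<dots> \<le> (\<Sum>ji\<in>J. measure_pmf.prob (channel_output Adv (codeword u k))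
          {y. k (snd ji) \<in> risky u (take (fst ji * b) y) (snd ji)})"
      using finJ by (intro measure_pmf.finite_measure_subadditive_finite) auto
    finally show ?thesis by (simp add: case_prod_unfold)
  qed
  then have "(\<Sum>k\<in>keys. measure_pmf.prob (channel_output Adv (codeword u k)) {y. confusable u y})
      \<le> (\<Sum>k\<in>keys. \<Sum>(j, i)\<in>J. measure_pmf.prob (channel_output Adv (codeword u k))
          {y. k i \<in> risky u (take (j * b) y) i})"
    by (rule sum_mono)
  also have "\<dots> = (\<Sum>(j, i)\<in>J. \<Sum>k\<in>keys. measure_pmf.prob (channel_output Adv (codeword u k))
          {y. k i \<in> risky u (take (j * b) y) i})"
    by (subst sum.swap) (simp add: case_prod_unfold)
  also have "\<dots> \<le> (\<Sum>(j, i)\<in>J. real (K ^ (T - 1) * (q * m)))"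
  proof (rule sum_mono)
    fix x assume "x \<in> J"
    then show "(case x of (j, i) \<Rightarrow> \<Sum>k\<in>keys. measure_pmf.prob (channel_output Adv (codeword u k))
        {y. k i \<in> risky u (take (j * b) y) i}) \<le> (case x of (j, i) \<Rightarrow> real (K ^ (T - 1) * (q * m)))"
      using sum_prob_risky[OF u, of "snd x" "fst x" Adv] by (auto simp: J_def)
  qed
  also have "\<dots> = real (card J * (K ^ (T - 1) * (q * m)))" by simp
  also have "\<dots> \<le> real (T * T * (K ^ (T - 1) * (q * m)))"
    using cardJ by (intro of_nat_mono mult_right_mono) auto
  finally show ?thesis .
qed

section \<open>Encoder, decoder and average error\<close>

lemma T_pos: "0 < T"
  using M_pos M_le by (cases T) auto

text \<open>The condition is that the codeword is not confusable even without erasures, that is, it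
  is no codeword of another message. Restricting the encoder to such keys makes it
  injective.\<close>

definition good_keys :: "'u \<Rightarrow> (nat \<Rightarrow> nat) set" where
  "good_keys u = {k\<in>keys. \<not> confusable u (map Some (codeword u k))}"

definition encode :: "'u \<Rightarrow> bool list pmf" where
  "encode u = map_pmf (codeword u) (pmf_of_set (good_keys u))"

text \<open>The default is an arbitrary message rather than an arbitrary value, as
  \<open>is_code\<close> restricts the decoder on all words.\<close>

definition decode :: "symbol list \<Rightarrow> 'u" where
  "decode y = (if \<exists>u\<in>Msgs. \<exists>k\<in>keys. agrees y (codeword u k)
    then SOME u. u \<in> Msgs \<and> (\<exists>k\<in>keys. agrees y (codeword u k)) else SOME u. u \<in> Msgs)"

lemma decode_in: "Msgs \<noteq> {} \<Longrightarrow> decode y \<in> Msgs"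
proof (cases "\<exists>u\<in>Msgs. \<exists>k\<in>keys. agrees y (codeword u k)")
  case True
  then have "\<exists>u. u \<in> Msgs \<and> (\<exists>k\<in>keys. agrees y (codeword u k))" by blast
  from someI_ex[OF this] True show ?thesis by (simp add: decode_def)
next
  case False
  assume "Msgs \<noteq> {}"
  then show ?thesis using False some_in_eq[of Msgs] by (auto simp: decode_def)
qed

lemma decode_neq_imp_confusable:
  assumes "u \<in> Msgs" "k \<in> keys" "agrees y (codeword u k)" "decode y \<noteq> u"
  shows "confusable u y"
proof -
  have ex: "\<exists>u. u \<in> Msgs \<and> (\<exists>k\<in>keys. agrees y (codeword u k))" using assms by blast
  then have "decode y = (SOME u. u \<in> Msgs \<and> (\<exists>k\<in>keys. agrees y (codeword u k)))"
    by (auto simp: decode_def)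
  then show ?thesis using someI_ex[OF ex] assms(4) by (auto simp: confusable_def)
qed

text \<open>The identity channel is causal, so the error bound also bounds the number of keys whose
  codeword collides with a codeword of another message.\<close>

lemma card_good_keys:
  assumes u: "u \<in> Msgs" and p: "0 \<le> p" and B: "p * real n + real (T * b - n) < real B + 1"
  shows "real (K ^ T) - real (T * T * (K ^ (T - 1) * (q * m))) \<le> real (card (good_keys u))"
proof -
  let ?Adv = "\<lambda>xs ys. return_pmf (Some (last xs))"
  have "output_prefix ?Adv x t = return_pmf (map Some (take t x))" if "t \<le> length x" for t x
    using that
    by (induction t) (simp_all add: bind_return_pmf take_Suc_conv_app_nth)
  then have out: "channel_output ?Adv x = return_pmf (map Some x)" for x
    by (simp add: channel_output_def)
  have "count_list (map Some x) None = 0" for x :: "bool list"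
    by (induction x) auto
  then have "?Adv \<in> CE p n" using p by (auto simp: CE_def out)
  from sum_prob_confusable[OF u this B]
  have "(\<Sum>k\<in>keys. indicator {k. confusable u (map Some (codeword u k))} k :: real)
      \<le> real (T * T * (K ^ (T - 1) * (q * m)))"
    by (simp add: out indicator_def)
  moreover have "(\<Sum>k\<in>keys. indicator {k. confusable u (map Some (codeword u k))} k :: real)
      = real (card (keys - good_keys u))"
    using finite_keys by (simp add: indicator_def sum.If_cases Int_def set_diff_eq good_keys_def)
      (metis (mono_tags, lifting))
  moreover have "card (keys - good_keys u) = K ^ T - card (good_keys u)"
    using finite_keys card_keys by (subst card_Diff_subset) (auto simp: good_keys_def)
  moreover have "card (good_keys u) \<le> K ^ T"
    unfolding card_keys[symmetric] using finite_keys by (intro card_mono) (auto simp: good_keys_def)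
  ultimately show ?thesis by simp
qed

lemma half_keys_good:
  assumes u: "u \<in> Msgs" and p: "0 \<le> p"
    and B: "p * real n + real (T * b - n) < real B + 1"
    and K: "0 < K" and \<gamma>: "real (T * T * (q * m)) \<le> \<gamma> * real K" "\<gamma> \<le> 1/2"
  shows "real (T * T * (K ^ (T - 1) * (q * m))) \<le> \<gamma> * real (K ^ T)"
    and "real (K ^ T) / 2 \<le> real (card (good_keys u))"
    and "good_keys u \<noteq> {}"
proof -
  have "K ^ T = K * K ^ (T - 1)" using T_pos by (cases T) auto
  then show KT: "real (T * T * (K ^ (T - 1) * (q * m))) \<le> \<gamma> * real (K ^ T)"
    using mult_right_mono[OF \<gamma>(1), of "real (K ^ (T - 1))"] by (simp add: mult_ac)
  have "\<gamma> * real (K ^ T) \<le> 1/2 * real (K ^ T)" using \<gamma>(2) by (intro mult_right_mono) auto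
  then show half: "real (K ^ T) / 2 \<le> real (card (good_keys u))"
    using card_good_keys[OF u p B] KT by simp
  moreover have "0 < real (K ^ T) / 2" using K by simp
  ultimately have "0 < real (card (good_keys u))" by linarith
  then show "good_keys u \<noteq> {}" by auto
qed

text \<open>The errors summed over the good keys are at most those summed over all keys, that is
  \<open>\<gamma> * K ^ T\<close>; the divisor is at least half of \<open>K ^ T\<close>, whence the
  factor 2.\<close>

lemma average_error_le:
  assumes u: "u \<in> Msgs" and Adv: "Adv \<in> CE p n" and p: "0 \<le> p"
    and B: "p * real n + real (T * b - n) < real B + 1"
    and K: "0 < K" and \<gamma>: "real (T * T * (q * m)) \<le> \<gamma> * real K" "\<gamma> \<le> 1/2"
  shows "measure_pmf.expectation (encode u)
          (\<lambda>x. measure_pmf.prob (channel_output Adv x) {y. decode y \<noteq> u}) \<le> 2 * \<gamma>"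
proof -
  note KT = half_keys_good(1)[OF u p B K \<gamma>] and half = half_keys_good(2)[OF u p B K \<gamma>]
    and ne = half_keys_good(3)[OF u p B K \<gamma>]
  have fin: "finite (good_keys u)" using finite_keys by (simp add: good_keys_def)
  then have pos: "0 < real (card (good_keys u))" using ne by (simp add: card_gt_0_iff)
  have "measure_pmf.expectation (encode u)
          (\<lambda>x. measure_pmf.prob (channel_output Adv x) {y. decode y \<noteq> u})
      = (\<Sum>k\<in>good_keys u. measure_pmf.prob (channel_output Adv (codeword u k)) {y. decode y \<noteq> u})
          / real (card (good_keys u))"
    by (simp add: encode_def integral_pmf_of_set[OF ne fin])
  also have "\<dots> \<le> (\<gamma> * real (K ^ T)) / real (card (good_keys u))"
  proof (rule divide_right_mono)
    have "(\<Sum>k\<in>good_keys u. measure_pmf.prob (channel_output Adv (codeword u k)) {y. decode y \<noteq> u})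
        \<le> (\<Sum>k\<in>good_keys u. measure_pmf.prob (channel_output Adv (codeword u k)) {y. confusable u y})"
    proof (rule sum_mono)
      fix k assume k: "k \<in> good_keys u"
      show "measure_pmf.prob (channel_output Adv (codeword u k)) {y. decode y \<noteq> u}
          \<le> measure_pmf.prob (channel_output Adv (codeword u k)) {y. confusable u y}"
        using k channel_output_support(3)[OF Adv length_codeword] decode_neq_imp_confusable[OF u]
        by (intro measure_pmf.finite_measure_mono_AE AE_pmfI) (auto simp: good_keys_def)
    qed
    also have "\<dots> \<le> (\<Sum>k\<in>keys. measure_pmf.prob (channel_output Adv (codeword u k)) {y. confusable u y})"
      using finite_keys by (intro sum_mono2) (auto simp: good_keys_def)
    also have "\<dots> \<le> \<gamma> * real (K ^ T)"
      using sum_prob_confusable[OF u Adv B] KT by linarith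
    finally show "(\<Sum>k\<in>good_keys u. measure_pmf.prob (channel_output Adv (codeword u k)) {y. decode y \<noteq> u})
        \<le> \<gamma> * real (K ^ T)" .
  qed (use pos in simp)
  also have "\<dots> \<le> 2 * \<gamma>"
  proof -
    have "0 \<le> \<gamma> * real K" using \<gamma>(1) by (rule order_trans[rotated]) simp
    then have "0 \<le> \<gamma>" using K by (simp add: zero_le_mult_iff)
    then have "\<gamma> * real (K ^ T) \<le> \<gamma> * (2 * real (card (good_keys u)))"
      using half by (intro mult_left_mono) auto
    then show ?thesis using pos by (simp add: divide_le_eq mult_ac)
  qed
  finally show "measure_pmf.expectation (encode u)
          (\<lambda>x. measure_pmf.prob (channel_output Adv x) {y. decode y \<noteq> u}) \<le> 2 * \<gamma>" .
qed

end

section \<open>From average error to \<open>P_max\<close>\<close>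

lemma finite_words: "finite (words n :: 'a::finite list set)"
  using finite_lists_length_eq[of "UNIV :: 'a set" n] by (simp add: words_def)

lemma card_messages: "card (messages n R) = 2 ^ nat \<lceil>real n * R\<rceil>"
  using card_lists_length_eq[of "UNIV :: bool set"] by (simp add: messages_def words_def)

lemma P_max_less:
  assumes "\<And>u. u \<in> messages n R \<Longrightarrow> set_pmf (Enc u) \<subseteq> words n"
    and "\<And>u. u \<in> messages n R \<Longrightarrow> measure_pmf.expectation (Enc u)
      (\<lambda>x. measure_pmf.prob (channel_output Adv x) {y. dec y \<noteq> u}) < \<beta>"
  shows "P_max n R Enc (\<lambda>y. return_pmf (dec y)) Adv < \<beta>"
proof -
  have fin: "finite (messages n R)" by (simp add: messages_def finite_words)
  have ne: "messages n R \<noteq> {}" using card_messages[of n R] by (metis card.empty power_not_zero zero_neq_numeral)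
  have "(\<Sum>x\<in>words n. pmf (Enc u) x * (\<Sum>y\<in>words n. pmf (channel_output Adv x) y *
      measure_pmf.prob (return_pmf (dec y)) {v. v \<noteq> u})) < \<beta>" if u: "u \<in> messages n R" for u
  proof -
    have "(\<Sum>y\<in>words n. pmf (channel_output Adv x) y * measure_pmf.prob (return_pmf (dec y)) {v. v \<noteq> u})
        \<le> measure_pmf.prob (channel_output Adv x) {y. dec y \<noteq> u}" for x
    proof -
      have "(\<Sum>y\<in>words n. pmf (channel_output Adv x) y * measure_pmf.prob (return_pmf (dec y)) {v. v \<noteq> u})
          = (\<Sum>y\<in>words n. if dec y \<noteq> u then pmf (channel_output Adv x) y else 0)"
        by (rule sum.cong) (auto simp: indicator_def)
      also have "\<dots> = (\<Sum>y\<in>{y\<in>words n. dec y \<noteq> u}. pmf (channel_output Adv x) y)"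
        by (simp add: sum.inter_filter finite_words)
      also have "\<dots> = measure_pmf.prob (channel_output Adv x) {y\<in>words n. dec y \<noteq> u}"
        by (simp add: measure_measure_pmf_finite finite_words)
      also have "\<dots> \<le> measure_pmf.prob (channel_output Adv x) {y. dec y \<noteq> u}"
        by (intro measure_pmf.finite_measure_mono) auto
      finally show ?thesis .
    qed
    then have "(\<Sum>x\<in>words n. pmf (Enc u) x * (\<Sum>y\<in>words n. pmf (channel_output Adv x) y *
        measure_pmf.prob (return_pmf (dec y)) {v. v \<noteq> u}))
      \<le> (\<Sum>x\<in>words n. pmf (Enc u) x * measure_pmf.prob (channel_output Adv x) {y. dec y \<noteq> u})"
      by (intro sum_mono mult_left_mono) auto
    also have "\<dots> = measure_pmf.expectation (Enc u)
        (\<lambda>x. measure_pmf.prob (channel_output Adv x) {y. dec y \<noteq> u})"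
      using assms(1)[OF u] by (subst integral_measure_pmf_real[of "words n"]) (auto simp: finite_words mult.commute)
    finally show ?thesis using assms(2)[OF u] by linarith
  qed
  then show ?thesis unfolding P_max_def using fin ne by (subst Max_less_iff) auto
qed

lemma code_of_chunk_code:
  assumes "chunk_code n b T K (messages n R) F M q a m B"
    and p: "0 \<le> p" and B: "p * real n + real (T * b - n) < real B + 1"
    and K: "0 < K" and \<gamma>: "real (T * T * (q * m)) \<le> \<gamma> * real K" "\<gamma> \<le> 1/2" "2 * \<gamma> < \<beta>"
  shows "\<exists>Enc Dec. is_code n R Enc Dec \<and> (\<forall>Adv\<in>CE p n. P_max n R Enc Dec Adv < \<beta>)"
proof -
  interpret chunk_code n b T K "messages n R" F M q a m B by fact
  have ne: "messages n R \<noteq> {}" using card_messages[of n R] by (metis card.empty power_not_zero zero_neq_numeral)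
  note good_ne = half_keys_good(3)[OF _ p B K \<gamma>(1,2)]
  have fin: "finite (good_keys u)" for u using finite_keys by (simp add: good_keys_def)
  have supp: "set_pmf (encode u) = codeword u ` good_keys u" if "u \<in> messages n R" for u
    using good_ne[OF that] fin by (simp add: encode_def)
  have "is_code n R encode (\<lambda>y. return_pmf (decode y))"
    unfolding is_code_def
  proof (intro conjI ballI impI)
    fix u u' assume u: "u \<in> messages n R" "u' \<in> messages n R" "u \<noteq> u'"
    have "codeword u k \<noteq> codeword u' k'" if "k \<in> good_keys u" "k' \<in> good_keys u'" for k k'
    proof
      assume "codeword u k = codeword u' k'"
      then have "agrees (map Some (codeword u k)) (codeword u' k')" by (auto simp: agrees_def)
      then show False using that u by (auto simp: good_keys_def confusable_def)
    qed
    then show "set_pmf (encode u) \<inter> set_pmf (encode u') = {}" using supp u by auto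
  qed (use supp decode_in[OF ne] in \<open>auto simp: words_def\<close>)
  moreover have "P_max n R encode (\<lambda>y. return_pmf (decode y)) Adv < \<beta>" if "Adv \<in> CE p n" for Adv
    using average_error_le[OF _ that p B K \<gamma>(1,2)] \<gamma>(3) supp
    by (intro P_max_less) (force simp: words_def)+
  ultimately show ?thesis by blast
qed

section \<open>Existence by counting\<close>

text \<open>For a uniformly random subset of \<open>D\<close> this says that an event has
  probability at most 2^(-|E|) if it lets the entries in \<open>E\<close> be recovered from the
  others. The recovered values may depend on those other entries.\<close>

lemma card_Pow_determined:
  assumes D: "finite D" "E \<subseteq> D" and A: "A \<subseteq> Pow D" and inj: "inj_on (\<lambda>F. F - E) A"
  shows "real (card A) \<le> 2 ^ card D / 2 ^ card E"
proof -
  have "card A \<le> card (Pow (D - E))"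
    using D A by (intro card_inj_on_le[OF inj]) auto
  also have "\<dots> = 2 ^ (card D - card E)"
    using D by (simp add: card_Pow card_Diff_subset finite_subset)
  finally have "real (card A) \<le> real (2 ^ (card D - card E))" by (rule of_nat_mono)
  also have "\<dots> = 2 ^ card D / 2 ^ card E"
    using power_diff[of "2 :: real" "card E" "card D"] card_mono[OF D] by simp
  finally show ?thesis .
qed

lemma obtain_distinct_list:
  assumes "q \<le> card U" "finite U"
  obtains us where "distinct us" "set us \<subseteq> U" "length us = q"
proof -
  obtain V where "V \<subseteq> U" "card V = q" "finite V"
    using obtain_subset_with_card_n[OF assms(1)] by metis
  then show ?thesis using finite_distinct_list[of V] that distinct_card by metis
qed

lemma card_distinct_fst_lists:
  assumes "finite A"
  shows "finite {ls. set ls \<subseteq> A \<and> length ls = l \<and> distinct (map fst ls)}"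
    and "card {ls. set ls \<subseteq> A \<and> length ls = l \<and> distinct (map fst ls)} \<le> card A ^ l"
proof -
  have sub: "{ls. set ls \<subseteq> A \<and> length ls = l \<and> distinct (map fst ls)} \<subseteq> {ls. set ls \<subseteq> A \<and> length ls = l}"
    by auto
  note fin = finite_lists_length_eq[OF assms, of l]
  show "finite {ls. set ls \<subseteq> A \<and> length ls = l \<and> distinct (map fst ls)}"
    using finite_subset[OF sub fin] .
  show "card {ls. set ls \<subseteq> A \<and> length ls = l \<and> distinct (map fst ls)} \<le> card A ^ l"
    using card_mono[OF fin sub] card_lists_length_eq[OF assms, of l] by simp
qed

text \<open>Distinct messages use disjoint parts of the array, so the event prescribes
  \<open>q * card P\<close> different bits, whatever the key sequences are.\<close>

lemma list_event_bound:
  fixes Msgs :: "'u set" and T b K :: nat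
  assumes fin: "finite Msgs"
    and ls: "set ls \<subseteq> Msgs \<times> PiE {..<T} (\<lambda>_. {..<K})" "distinct (map fst ls)"
    and P: "P \<subseteq> {..<T * b}" and len: "length ls = q"
  shows "real (card {F\<in>Pow (Msgs \<times> {..<T * b} \<times> {..<K}).
      \<forall>(u, k)\<in>set ls. \<forall>i\<in>P. (u, i, k (i div b)) \<in> F \<longleftrightarrow> i \<in> v})
    \<le> 2 ^ card (Msgs \<times> {..<T * b} \<times> {..<K}) / 2 ^ (q * card P)"
proof -
  let ?f = "\<lambda>((u, k), i). (u, i, k (i div b))"
  define E where "E = ?f ` (set ls \<times> P)"
  have "inj_on ?f (set ls \<times> P)"
  proof (rule inj_onI)
    fix x y assume x: "x \<in> set ls \<times> P" and y: "y \<in> set ls \<times> P" and eq: "?f x = ?f y"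
    have "inj_on fst (set ls)" using ls(2) by (simp add: distinct_map)
    from inj_onD[OF this, of "fst x" "fst y"] show "x = y"
      using x y eq by (auto simp: case_prod_unfold intro: prod_eqI)
  qed
  then have "card E = card (set ls \<times> P)" unfolding E_def by (rule card_image)
  moreover have "card (set ls) = q" using ls(2) len by (simp add: distinct_map distinct_card)
  ultimately have cardE: "card E = q * card P" by (simp add: card_cartesian_product)
  have E_sub: "E \<subseteq> Msgs \<times> {..<T * b} \<times> {..<K}"
  proof
    fix x assume "x \<in> E"
    then obtain u k i where x: "x = (u, i, k (i div b))" "(u, k) \<in> set ls" "i \<in> P"
      by (auto simp: E_def)
    have "i < T * b" using x P by auto
    then have "i div b < T" by (rule less_mult_imp_div_less)
    moreover have "u \<in> Msgs" "k \<in> PiE {..<T} (\<lambda>_. {..<K})" using x ls by auto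
    ultimately show "x \<in> Msgs \<times> {..<T * b} \<times> {..<K}"
      using x \<open>i < T * b\<close> by (auto dest: PiE_mem)
  qed
  show ?thesis unfolding cardE[symmetric]
  proof (rule card_Pow_determined[OF _ E_sub], goal_cases)
    case 3
    show ?case
    proof (rule inj_onI)
      fix F F'
      assume F: "F \<in> {F\<in>Pow (Msgs \<times> {..<T * b} \<times> {..<K}). \<forall>(u, k)\<in>set ls. \<forall>i\<in>P. (u, i, k (i div b)) \<in> F \<longleftrightarrow> i \<in> v}"
        and F': "F' \<in> {F\<in>Pow (Msgs \<times> {..<T * b} \<times> {..<K}). \<forall>(u, k)\<in>set ls. \<forall>i\<in>P. (u, i, k (i div b)) \<in> F \<longleftrightarrow> i \<in> v}"
        and eq: "F - E = F' - E"
      have "x \<in> F \<longleftrightarrow> x \<in> F'" if "x \<in> E" for x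
        using that F F' by (force simp: E_def)
      then show "F = F'" using eq by blast
    qed
  qed (use fin in auto)
qed

text \<open>Given the bits of u', each difference set S determines the bits of u under the key
  \<kappa>. Only bits of u are counted as forced: the keys \<kappa> are distinct, whereas the
  partners \<kappa>' may repeat.\<close>

lemma bad_key_event_bound:
  fixes Msgs :: "'u set" and T b K :: nat
  assumes fin: "finite Msgs" and u: "u \<in> Msgs" "u \<noteq> u'"
    and ls: "set ls \<subseteq> {..<K} \<times> {..<K} \<times> X" "distinct (map fst ls)"
    and C: "C \<subseteq> {..<T * b}" and len: "length ls = m"
  shows "real (card {F\<in>Pow (Msgs \<times> {..<T * b} \<times> {..<K}).
      \<forall>(\<kappa>, \<kappa>', S)\<in>set ls. \<forall>s\<in>C. ((u, s, \<kappa>) \<in> F) \<noteq> ((u', s, \<kappa>') \<in> F) \<longleftrightarrow> s \<in> S})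
    \<le> 2 ^ card (Msgs \<times> {..<T * b} \<times> {..<K}) / 2 ^ (m * card C)"
proof -
  define E where "E = {u} \<times> C \<times> fst ` set ls"
  have "card (fst ` set ls) = m" using ls(2) len by (metis distinct_card length_map list.set_map)
  then have cardE: "card E = m * card C" by (simp add: E_def card_cartesian_product)
  have E_sub: "E \<subseteq> Msgs \<times> {..<T * b} \<times> {..<K}"
    using u ls C by (auto simp: E_def)
  show ?thesis unfolding cardE[symmetric]
  proof (rule card_Pow_determined[OF _ E_sub], goal_cases)
    case 3
    show ?case
    proof (rule inj_onI)
      fix F F'
      assume F: "F \<in> {F\<in>Pow (Msgs \<times> {..<T * b} \<times> {..<K}). \<forall>(\<kappa>, \<kappa>', S)\<in>set ls. \<forall>s\<in>C. ((u, s, \<kappa>) \<in> F) \<noteq> ((u', s, \<kappa>') \<in> F) \<longleftrightarrow> s \<in> S}"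
        and F': "F' \<in> {F\<in>Pow (Msgs \<times> {..<T * b} \<times> {..<K}). \<forall>(\<kappa>, \<kappa>', S)\<in>set ls. \<forall>s\<in>C. ((u, s, \<kappa>) \<in> F) \<noteq> ((u', s, \<kappa>') \<in> F) \<longleftrightarrow> s \<in> S}"
        and eq: "F - E = F' - E"
      have "x \<in> F \<longleftrightarrow> x \<in> F'" if "x \<in> E" for x
      proof -
        obtain s \<kappa> where s: "x = (u, s, \<kappa>)" "s \<in> C" "\<kappa> \<in> fst ` set ls"
          using \<open>x \<in> E\<close> unfolding E_def by (elim SigmaE) simp
        obtain e where "e \<in> set ls" "\<kappa> = fst e" using s(3) by (rule imageE)
        then obtain \<kappa>' S where x: "x = (u, s, \<kappa>)" "s \<in> C" "(\<kappa>, \<kappa>', S) \<in> set ls"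
          using s(1,2) by (metis prod.collapse)
        have "(u', s, \<kappa>') \<notin> E" using u(2) by (auto simp: E_def)
        then have "(u', s, \<kappa>') \<in> F \<longleftrightarrow> (u', s, \<kappa>') \<in> F'" using eq by blast
        moreover have "((u, s, \<kappa>) \<in> F) \<noteq> ((u', s, \<kappa>') \<in> F) \<longleftrightarrow> s \<in> S" using F x by fast
        moreover have "((u, s, \<kappa>) \<in> F') \<noteq> ((u', s, \<kappa>') \<in> F') \<longleftrightarrow> s \<in> S" using F' x by fast
        ultimately show ?thesis using x(1) by blast
      qed
      then show "F = F'" using eq by blast
    qed
  qed (use fin in auto)
qed

text \<open>A union bound over witnesses of failure. Too long a list yields P, v and
  \<open>q\<close> messages with key sequences; too many bad keys yield a pair of messages, a chunk
  and \<open>m\<close> keys, each with a partner and a small difference set. The numerators in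
  \<open>union\<close> count these witnesses, the denominators come from the bits they
  force.\<close>

lemma chunk_code_exists:
  fixes Msgs :: "'u set" and V :: real
  assumes fin: "finite Msgs" and n: "n \<le> T * b"
    and V: "\<And>C :: nat set. finite C \<Longrightarrow> card C = b \<Longrightarrow> real (card {S\<in>Pow C. card S \<le> a}) \<le> V"
    and union: "4 ^ n * (real (card Msgs) * real K ^ T) ^ q / 2 ^ (q * M)
      + real (card Msgs) ^ 2 * real T * (real K ^ 2 * V) ^ m / 2 ^ (m * b) < 1"
  obtains F :: "('u \<times> nat \<times> nat) set" where
    "\<And>P v. P \<subseteq> {..<n} \<Longrightarrow> v \<subseteq> P \<Longrightarrow> M \<le> card P \<Longrightarrow>
      card {u\<in>Msgs. \<exists>k\<in>PiE {..<T} (\<lambda>_. {..<K}). \<forall>i\<in>P. (u, i, k (i div b)) \<in> F \<longleftrightarrow> i \<in> v} < q"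
    "\<And>u u' i. u \<in> Msgs \<Longrightarrow> u' \<in> Msgs \<Longrightarrow> u \<noteq> u' \<Longrightarrow> i < T \<Longrightarrow>
      card {\<kappa>\<in>{..<K}. \<exists>\<kappa>'<K. card {s\<in>{i*b..<i*b+b}. ((u, s, \<kappa>) \<in> F) \<noteq> ((u', s, \<kappa>') \<in> F)} \<le> a} < m"
proof -
  define D where "D = Msgs \<times> {..<T * b} \<times> {..<K}"
  define Keys where "Keys = PiE {..<T} (\<lambda>_. {..<K})"
  define chunk where "chunk i = {i*b..<i*b+b}" for i
  define X where "X i = {S\<in>Pow (chunk i). card S \<le> a}" for i
  define LA where "LA = {ls. set ls \<subseteq> Msgs \<times> Keys \<and> length ls = q \<and> distinct (map fst ls)}"
  define LB where "LB i = {ls. set ls \<subseteq> {..<K} \<times> {..<K} \<times> X i \<and> length ls = m \<and> distinct (map fst ls)}" for i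
  define IA where "IA = {P\<in>Pow {..<n}. M \<le> card P} \<times> Pow {..<n} \<times> LA"
  define IB where "IB = Msgs \<times> Msgs \<times> (SIGMA i:{..<T}. LB i)"
  define evA where "evA = (\<lambda>(P, v, ls). {F\<in>Pow D. \<forall>(u, k)\<in>set ls. \<forall>i\<in>P. (u, i, k (i div b)) \<in> F \<longleftrightarrow> i \<in> v})"
  \<comment> \<open>Giving pairs with u = u' the empty event keeps the index set \<open>IB\<close>
    free of a side condition.\<close>
  define evB where "evB = (\<lambda>(u, u', i, ls). if u = u' then {} else
    {F\<in>Pow D. \<forall>(\<kappa>, \<kappa>', S)\<in>set ls. \<forall>s\<in>chunk i. ((u, s, \<kappa>) \<in> F) \<noteq> ((u', s, \<kappa>') \<in> F) \<longleftrightarrow> s \<in> S})"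
  have finKeys: "finite Keys" "card Keys = K ^ T" by (simp_all add: Keys_def finite_PiE card_PiE)
  have finX: "finite (X i)" for i by (simp add: X_def chunk_def)
  have finD: "finite D" using fin by (simp add: D_def)
  have LA: "finite LA" "card LA \<le> card (Msgs \<times> Keys) ^ q"
    unfolding LA_def using fin finKeys by (intro card_distinct_fst_lists finite_cartesian_product; simp)+
  have LB: "finite (LB i)" "card (LB i) \<le> card ({..<K} \<times> {..<K} \<times> X i) ^ m" for i
    unfolding LB_def using finX by (intro card_distinct_fst_lists finite_cartesian_product; simp)+
  have finIA: "finite IA" using LA by (simp add: IA_def)
  have finIB: "finite IB" using LB fin by (auto simp: IB_def)
  have cardIA: "real (card IA) \<le> 4 ^ n * (real (card Msgs) * real K ^ T) ^ q"
  proof -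
    have "card {P\<in>Pow {..<n}. M \<le> card P} \<le> card (Pow {..<n})" by (rule card_mono) auto
    then have "card IA \<le> 2 ^ n * (2 ^ n * card (Msgs \<times> Keys) ^ q)"
      unfolding IA_def card_cartesian_product using LA(2)[unfolded card_cartesian_product]
      by (intro mult_mono) (simp_all add: card_Pow)
    then have "real (card IA) \<le> real (2 ^ n * (2 ^ n * card (Msgs \<times> Keys) ^ q))" by (rule of_nat_mono)
    also have "\<dots> = (2 * 2) ^ n * (real (card Msgs) * real K ^ T) ^ q"
      unfolding power_mult_distrib[of "2 :: real"] by (simp add: card_cartesian_product finKeys)
    finally show ?thesis by simp
  qed
  have cardIB: "real (card IB) \<le> real (card Msgs) ^ 2 * real T * (real K ^ 2 * V) ^ m"
  proof -
    have "real (card (LB i)) \<le> (real K ^ 2 * V) ^ m" for i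
    proof -
      have "real (card (LB i)) \<le> real (card ({..<K} \<times> {..<K} \<times> X i) ^ m)"
        using LB(2) by (rule of_nat_mono)
      also have "\<dots> = (real K ^ 2 * real (card (X i))) ^ m"
        by (simp add: card_cartesian_product power2_eq_square mult.assoc)
      also have "\<dots> \<le> (real K ^ 2 * V) ^ m"
        using V[of "chunk i"] unfolding X_def by (intro power_mono mult_left_mono) (auto simp: chunk_def)
      finally show ?thesis .
    qed
    then have "(\<Sum>i<T. real (card (LB i))) \<le> (\<Sum>i<T. (real K ^ 2 * V) ^ m)" by (intro sum_mono)
    then have "real (card Msgs * card Msgs) * (\<Sum>i<T. real (card (LB i)))
        \<le> real (card Msgs * card Msgs) * (real T * (real K ^ 2 * V) ^ m)"
      by (intro mult_left_mono) auto
    moreover have "real (card IB) = real (card Msgs * card Msgs) * (\<Sum>i<T. real (card (LB i)))"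
      unfolding IB_def card_cartesian_product using LB(1) by (subst card_SigmaI) auto
    ultimately show ?thesis by (simp add: power2_eq_square mult.assoc)
  qed
  have evA: "real (card (evA x)) \<le> 2 ^ card D / 2 ^ (q * M)" if "x \<in> IA" for x
  proof -
    obtain P v ls where x: "x = (P, v, ls)" by (cases x)
    have "real (card (evA x)) \<le> 2 ^ card D / 2 ^ (q * card P)"
      using that n unfolding x evA_def D_def case_prod_conv
      by (intro list_event_bound[OF fin]) (auto simp: IA_def LA_def Keys_def)
    also have "\<dots> \<le> 2 ^ card D / 2 ^ (q * M)"
      using that x by (intro divide_left_mono power_increasing) (auto simp: IA_def)
    finally show ?thesis .
  qed
  have evB: "real (card (evB x)) \<le> 2 ^ card D / 2 ^ (m * b)" if "x \<in> IB" for x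
  proof -
    obtain u u' i ls where x: "x = (u, u', i, ls)" by (cases x)
    show ?thesis
    proof (cases "u = u'")
      case False
      have "chunk i \<subseteq> {..<T * b}"
      proof -
        have "Suc i * b \<le> T * b" using that x by (intro mult_le_mono1) (auto simp: IB_def)
        then show ?thesis by (auto simp: chunk_def)
      qed
      then have "real (card (evB x)) \<le> 2 ^ card D / 2 ^ (m * card (chunk i))"
        using that False unfolding x evB_def D_def case_prod_conv if_not_P[OF False]
        by (intro bad_key_event_bound[OF fin, where X = "X i"]) (auto simp: IB_def LB_def)
      then show ?thesis by (simp add: chunk_def)
    qed (simp add: x evB_def)
  qed
  have "real (card ((\<Union>x\<in>IA. evA x) \<union> (\<Union>x\<in>IB. evB x)))
      \<le> real (card (\<Union>x\<in>IA. evA x)) + real (card (\<Union>x\<in>IB. evB x))"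
    using card_Un_le[of "\<Union>x\<in>IA. evA x" "\<Union>x\<in>IB. evB x"] by linarith
  also have "\<dots> \<le> (\<Sum>x\<in>IA. real (card (evA x))) + (\<Sum>x\<in>IB. real (card (evB x)))"
    using card_UN_le[OF finIA, of evA] card_UN_le[OF finIB, of evB]
    by (intro add_mono) (simp_all flip: of_nat_sum)
  also have "\<dots> \<le> (\<Sum>x\<in>IA. 2 ^ card D / 2 ^ (q * M)) + (\<Sum>x\<in>IB. 2 ^ card D / 2 ^ (m * b))"
    using evA evB by (intro add_mono sum_mono)
  also have "\<dots> = (real (card IA) / 2 ^ (q * M) + real (card IB) / 2 ^ (m * b)) * 2 ^ card D"
    by (simp add: algebra_simps)
  also have "\<dots> < 1 * 2 ^ card D"
  proof (rule mult_strict_right_mono)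
    have "real (card IA) / 2 ^ (q * M) + real (card IB) / 2 ^ (m * b)
        \<le> 4 ^ n * (real (card Msgs) * real K ^ T) ^ q / 2 ^ (q * M)
          + real (card Msgs) ^ 2 * real T * (real K ^ 2 * V) ^ m / 2 ^ (m * b)"
      using cardIA cardIB by (intro add_mono divide_right_mono) auto
    then show "real (card IA) / 2 ^ (q * M) + real (card IB) / 2 ^ (m * b) < 1" using union by simp
  qed simp
  also have "1 * 2 ^ card D = real (card (Pow D))" using finD by (simp add: card_Pow)
  finally have less: "card ((\<Union>x\<in>IA. evA x) \<union> (\<Union>x\<in>IB. evB x)) < card (Pow D)" by simp
  have "\<not> Pow D \<subseteq> (\<Union>x\<in>IA. evA x) \<union> (\<Union>x\<in>IB. evB x)"
  proof
    assume sub: "Pow D \<subseteq> (\<Union>x\<in>IA. evA x) \<union> (\<Union>x\<in>IB. evB x)"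
    have "evA x \<subseteq> Pow D" "evB z \<subseteq> Pow D" for x z
      unfolding evA_def evB_def by (auto simp only: case_prod_unfold split: if_splits)
    then have "(\<Union>x\<in>IA. evA x) \<union> (\<Union>x\<in>IB. evB x) \<subseteq> Pow D" by blast
    then have "finite ((\<Union>x\<in>IA. evA x) \<union> (\<Union>x\<in>IB. evB x))"
      using finD finite_subset by blast
    from card_mono[OF this sub] less show False by simp
  qed
  then obtain F where F: "F \<in> Pow D" "\<And>x. x \<in> IA \<Longrightarrow> F \<notin> evA x" "\<And>x. x \<in> IB \<Longrightarrow> F \<notin> evB x" by blast
  show ?thesis
  proof (rule that)
    fix P v assume P: "P \<subseteq> {..<n}" "v \<subseteq> P" "M \<le> card P"
    define U where "U = {u\<in>Msgs. \<exists>k\<in>PiE {..<T} (\<lambda>_. {..<K}). \<forall>i\<in>P. (u, i, k (i div b)) \<in> F \<longleftrightarrow> i \<in> v}"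
    have "card U < q"
    proof (rule ccontr)
      assume "\<not> ?thesis"
      then have "q \<le> card U" by simp
      moreover have "finite U" using fin by (simp add: U_def)
      ultimately obtain us where us: "distinct us" "set us \<subseteq> U" "length us = q"
        by (rule obtain_distinct_list)
      have "\<forall>u\<in>U. \<exists>k. u \<in> Msgs \<and> k \<in> Keys \<and> (\<forall>i\<in>P. (u, i, k (i div b)) \<in> F \<longleftrightarrow> i \<in> v)"
        by (auto simp: Keys_def U_def)
      from bchoice[OF this] obtain \<phi> where \<phi>:
        "\<forall>u\<in>U. u \<in> Msgs \<and> \<phi> u \<in> Keys \<and> (\<forall>i\<in>P. (u, i, \<phi> u (i div b)) \<in> F \<longleftrightarrow> i \<in> v)"
        by (rule exE)
      define ls where "ls = map (\<lambda>u. (u, \<phi> u)) us"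
      have "map fst ls = us" by (simp add: ls_def o_def)
      moreover have "set ls \<subseteq> Msgs \<times> Keys" using us(2) \<phi> by (auto simp: ls_def)
      ultimately have "ls \<in> LA" using us by (simp add: LA_def ls_def)
      then have "(P, v, ls) \<in> IA" using P by (auto simp: IA_def)
      moreover have "\<forall>(u, k)\<in>set ls. \<forall>i\<in>P. (u, i, k (i div b)) \<in> F \<longleftrightarrow> i \<in> v"
        using us(2) \<phi> by (auto simp: ls_def)
      then have "F \<in> evA (P, v, ls)" using F(1) by (simp add: evA_def)
      ultimately show False using F(2) by blast
    qed
    then show "card {u\<in>Msgs. \<exists>k\<in>PiE {..<T} (\<lambda>_. {..<K}). \<forall>i\<in>P. (u, i, k (i div b)) \<in> F \<longleftrightarrow> i \<in> v} < q"
      by (simp only: U_def)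
  next
    fix u u' i assume u: "u \<in> Msgs" "u' \<in> Msgs" "u \<noteq> u'" "i < T"
    define d where "d \<kappa> \<kappa>' = {s\<in>{i*b..<i*b+b}. ((u, s, \<kappa>) \<in> F) \<noteq> ((u', s, \<kappa>') \<in> F)}" for \<kappa> \<kappa>'
    define W where "W = {\<kappa>\<in>{..<K}. \<exists>\<kappa>'<K. card (d \<kappa> \<kappa>') \<le> a}"
    have "card W < m"
    proof (rule ccontr)
      assume "\<not> ?thesis"
      then have "m \<le> card W" by simp
      moreover have "finite W" by (simp add: W_def)
      ultimately obtain \<kappa>s where \<kappa>s: "distinct \<kappa>s" "set \<kappa>s \<subseteq> W" "length \<kappa>s = m"
        by (rule obtain_distinct_list)
      have "\<forall>\<kappa>\<in>W. \<exists>\<kappa>'. \<kappa> < K \<and> \<kappa>' < K \<and> card (d \<kappa> \<kappa>') \<le> a" by (auto simp: W_def)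
      from bchoice[OF this] obtain \<phi> where \<phi>: "\<forall>\<kappa>\<in>W. \<kappa> < K \<and> \<phi> \<kappa> < K \<and> card (d \<kappa> (\<phi> \<kappa>)) \<le> a"
        by (rule exE)
      define ls where "ls = map (\<lambda>\<kappa>. (\<kappa>, \<phi> \<kappa>, d \<kappa> (\<phi> \<kappa>))) \<kappa>s"
      have "map fst ls = \<kappa>s" by (simp add: ls_def o_def)
      moreover have "d \<kappa> \<kappa>' \<subseteq> chunk i" for \<kappa> \<kappa>' by (auto simp: d_def chunk_def)
      then have "set ls \<subseteq> {..<K} \<times> {..<K} \<times> X i"
        using \<kappa>s(2) \<phi> by (auto simp: ls_def X_def)
      ultimately have "ls \<in> LB i" using \<kappa>s by (simp add: LB_def ls_def)
      then have "(u, u', i, ls) \<in> IB" using u by (simp add: IB_def)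
      moreover have "\<forall>(\<kappa>, \<kappa>', S)\<in>set ls. \<forall>s\<in>chunk i. ((u, s, \<kappa>) \<in> F) \<noteq> ((u', s, \<kappa>') \<in> F) \<longleftrightarrow> s \<in> S"
        by (auto simp: ls_def d_def chunk_def)
      then have "F \<in> evB (u, u', i, ls)" using F(1) u(3) by (simp add: evB_def)
      ultimately show False using F(3) by blast
    qed
    then show "card {\<kappa>\<in>{..<K}. \<exists>\<kappa>'<K. card {s\<in>{i*b..<i*b+b}. ((u, s, \<kappa>) \<in> F) \<noteq> ((u', s, \<kappa>') \<in> F)} \<le> a} < m"
      by (simp only: W_def d_def)
  qed
qed

section \<open>Choice of parameters\<close>

text \<open>A Chernoff-type bound: each small set has weight at least t^a, and the weights t^|S| of
  all subsets sum to (1 + t)^|C|.\<close>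

lemma card_small_subsets_le:
  fixes t :: real
  assumes "finite C" "0 < t" "t \<le> 1"
  shows "real (card {S\<in>Pow C. card S \<le> a}) * t ^ a \<le> (1 + t) ^ card C"
proof -
  have "real (card {S\<in>Pow C. card S \<le> a}) * t ^ a = (\<Sum>S\<in>{S\<in>Pow C. card S \<le> a}. t ^ a)"
    by simp
  also have "\<dots> \<le> (\<Sum>S\<in>{S\<in>Pow C. card S \<le> a}. t ^ card S)"
    using assms by (intro sum_mono power_decreasing) auto
  also have "\<dots> \<le> (\<Sum>S\<in>Pow C. t ^ card S)"
    using assms by (intro sum_mono2) auto
  also have "\<dots> = (\<Prod>x\<in>C. t + 1)"
    using prod_add[OF assms(1), of "\<lambda>_. t" "\<lambda>_. 1"] by simp
  finally show ?thesis by (simp add: add.commute)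
qed

text \<open>For t = exp(-s) the preceding bound becomes h(s)^|C|. Since h(0) = 2 and h'(0) =
  -2\<delta>, a small s > 0 brings the base below 2.\<close>

lemma card_small_subsets_less_2_power:
  fixes \<delta> :: real
  assumes "0 < \<delta>"
  obtains \<rho> where "0 < \<rho>" "\<rho> < 2"
    "\<And>C a. finite (C :: 'a set) \<Longrightarrow> real a \<le> (1/2 - \<delta>) * real (card C) \<Longrightarrow>
      real (card {S\<in>Pow C. card S \<le> a}) \<le> \<rho> ^ card C"
proof -
  let ?h = "\<lambda>s. (1 + exp (- s)) * exp (s * (1/2 - \<delta>)) :: real"
  have "(?h has_real_derivative (- 2 * \<delta>)) (at 0)"
    by (auto intro!: derivative_eq_intros)
  then obtain d where d: "0 < d" "\<And>s. 0 < s \<Longrightarrow> s < d \<Longrightarrow> ?h (0 + s) < ?h 0"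
    using DERIV_neg_dec_right[of ?h "- 2 * \<delta>" 0] assms by auto
  define s where "s = d / 2"
  define \<rho> where "\<rho> = ?h s"
  have s: "0 < s" "\<rho> < 2" using d(1) d(2)[of s] by (simp_all add: s_def \<rho>_def)
  show ?thesis
  proof (rule that[of \<rho>])
    show "0 < \<rho>" by (simp add: \<rho>_def add_pos_pos)
    show "\<rho> < 2" using s by simp
    fix C :: "'a set" and a assume C: "finite C" "real a \<le> (1/2 - \<delta>) * real (card C)"
    have "real (card {S\<in>Pow C. card S \<le> a}) = real (card {S\<in>Pow C. card S \<le> a}) * exp (- s) ^ a * exp (s * real a)"
      by (simp add: exp_of_nat_mult[symmetric] mult.assoc mult_exp_exp mult.commute)
    also have "\<dots> \<le> (1 + exp (- s)) ^ card C * exp (s * ((1/2 - \<delta>) * real (card C)))"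
      using C s card_small_subsets_le[of C "exp (- s)" a] by (intro mult_mono) auto
    also have "\<dots> = \<rho> ^ card C"
      by (simp add: \<rho>_def power_mult_distrib exp_of_nat_mult[symmetric] mult_ac)
    finally show "real (card {S\<in>Pow C. card S \<le> a}) \<le> \<rho> ^ card C" .
  qed
qed

text \<open>The right-hand side grows with \<open>j * b\<close>, so \<open>j * b\<close> =
  \<open>M\<close> is the worst case, and the claim reduces to B + M/2 + b \<le> n/2 -
  n\<epsilon>/16. Here M/2 leaves a reserve of n\<epsilon>/4. One n\<epsilon>/16 pays for
  \<open>b\<close>, another for the deviation of \<open>a\<close> from b/2, and the remaining
  n\<epsilon>/8 covers the rounding terms T + 3/2.\<close>

lemma slack_inequality:
  fixes p R \<epsilon> :: real and n T M B b a j :: nat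
  assumes R: "R \<le> 1 - 2 * p - \<epsilon>" and \<epsilon>: "0 < \<epsilon>" "\<epsilon> \<le> 1" and T: "16 / \<epsilon> \<le> real T"
    and n: "8 * (real T + 2) \<le> real n * \<epsilon>"
    and b: "real b \<le> real n / real T + 1" "real n \<le> real T * real b"
    and B: "real B \<le> p * real n + real T"
    and M: "real M \<le> real n * (R + \<epsilon> / 2) + 1"
    and a: "(1/2 - \<epsilon> / 16) * real b \<le> real a + 1"
    and j: "j \<le> T" "M \<le> j * b"
  shows "B + M + b \<le> j * b + (T - j) * (a + 1)"
proof -
  define X where "X = real j * real b"
  have T0: "0 < real T" using T \<epsilon> by (smt (verit) divide_pos_pos)
  have "real n * 16 \<le> real n * (\<epsilon> * real T)"
    using T \<epsilon> by (intro mult_left_mono) (auto simp: field_simps)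
  then have "real n / real T \<le> real n * \<epsilon> / 16"
    using T0 by (simp add: field_simps)
  then have b': "real b \<le> real n * \<epsilon> / 16 + 1" using add_right_mono[of _ _ 1] by (intro order_trans[OF b(1)])
  have M': "real M \<le> real n - 2 * (p * real n) - real n * \<epsilon> / 2 + 1"
    using mult_left_mono[OF R, of "real n"] M by (simp add: algebra_simps)
  have "real M \<le> real (j * b)" using j(2) by (rule of_nat_mono)
  then have X: "real M \<le> X" by (simp add: X_def)
  define Y where "Y = (real T - real j) * (real a + 1)"
  define W where "W = (1/2 - \<epsilon> / 16) * (real T * real b)"
  define Z where "Z = \<epsilon> / 16 * X"
  \<comment> \<open>Rewriting in terms of X, W and Z leaves a linear problem; in X + Y the variable
    X gets the coefficient 1/2 + \<epsilon>/16.\<close>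
  have "(real T - real j) * ((1/2 - \<epsilon> / 16) * real b) \<le> Y"
    unfolding Y_def using a j by (intro mult_left_mono) auto
  also have "(real T - real j) * ((1/2 - \<epsilon> / 16) * real b) = W - X / 2 + Z"
    by (simp add: X_def W_def Z_def field_simps)
  finally have Y: "W - X / 2 + Z \<le> Y" .
  have "(1/2 - \<epsilon> / 16) * real n \<le> W"
    unfolding W_def using b(2) \<epsilon> by (intro mult_left_mono) auto
  also have "(1/2 - \<epsilon> / 16) * real n = real n / 2 - real n * \<epsilon> / 16"
    by (simp add: algebra_simps)
  finally have "real n / 2 - real n * \<epsilon> / 16 \<le> W" .
  moreover have "0 \<le> Z" using \<epsilon> by (simp add: X_def Z_def)
  ultimately have "real B + real M + real b \<le> X + Y"
    using Y B b' M' X n by (simp add: field_simps)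
  then have "real (B + M + b) \<le> real (j * b + (T - j) * (a + 1))"
    unfolding X_def Y_def of_nat_add of_nat_mult of_nat_diff[OF j(1)] by simp
  then show ?thesis by (simp only: of_nat_le_iff)
qed

text \<open>Both terms must beat 4^n, which counts P and v in the first and bounds the pairs of
  messages, up to a factor 4, in the second. The hypotheses on \<open>q\<close> and on (\<rho>/2)^m
  each provide a factor 8^(-n): a list entry gains 2^(-n\<epsilon>/4), so 12/\<epsilon> of them
  suffice, and a chunk gains 8^(-T b) \<le> 8^(-n). The factor 2 in the bound on \<open>N\<close>
  absorbs the ceiling in the message length.\<close>

lemma union_bound_less_1:
  fixes R \<epsilon> \<rho> N :: real and n T K q m M b :: nat
  assumes R: "R \<le> 1" and \<epsilon>: "0 < \<epsilon>" and \<rho>: "0 < \<rho>" "(\<rho> / 2) ^ m \<le> (1/8) ^ T"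
    and N: "0 \<le> N" "N \<le> 2 * 2 powr (real n * R)"
    and M: "real n * (R + \<epsilon> / 2) \<le> real M" and q: "12 / \<epsilon> \<le> real q"
    and b: "n \<le> T * b"
    and n: "2 * real K ^ T \<le> 2 powr (real n * \<epsilon> / 4)" "1 + 4 * real T * real K ^ (2 * m) < 2 ^ n"
  shows "4 ^ n * (N * real K ^ T) ^ q / 2 ^ (q * M)
      + N ^ 2 * real T * (real K ^ 2 * \<rho> ^ b) ^ m / 2 ^ (m * b) < 1"
proof -
  have "N * real K ^ T \<le> 2 * 2 powr (real n * R) * real K ^ T"
    using N by (intro mult_right_mono) auto
  also have "\<dots> = 2 powr (real n * R) * (2 * real K ^ T)" by simp
  also have "\<dots> \<le> 2 powr (real n * R) * 2 powr (real n * \<epsilon> / 4)"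
    using n by (intro mult_left_mono) auto
  also have "\<dots> = 2 powr (real n * (R + \<epsilon> / 2)) * 2 powr (- (real n * \<epsilon> / 4))"
    by (simp add: powr_add[symmetric] algebra_simps)
  also have "\<dots> \<le> 2 powr real M * 2 powr (- (real n * \<epsilon> / 4))"
    using M by (intro mult_right_mono powr_mono) auto
  finally have "(N * real K ^ T) ^ q \<le> (2 powr real M * 2 powr (- (real n * \<epsilon> / 4))) ^ q"
    using N by (intro power_mono) auto
  also have "\<dots> = 2 ^ (q * M) * 2 powr (- (real q * \<epsilon> * real n / 4))"
    by (simp add: power_mult_distrib powr_realpow power_mult[symmetric] powr_power mult_ac)
  also have "\<dots> \<le> 2 ^ (q * M) * 2 powr (- (3 * real n))"
  proof -
    have "12 * real n \<le> real q * \<epsilon> * real n"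
      using q \<epsilon> by (intro mult_right_mono) (auto simp: field_simps)
    then show ?thesis by (intro mult_left_mono powr_mono) auto
  qed
  also have "(2 :: real) powr (- (3 * real n)) = 1 / 8 ^ n"
  proof -
    have "(2 :: real) powr (3 * real n) = 2 ^ (3 * n)" using powr_realpow[of 2 "3 * n"] by simp
    then show ?thesis by (simp add: powr_minus_divide power_mult)
  qed
  finally have A: "4 ^ n * (N * real K ^ T) ^ q / 2 ^ (q * M) \<le> 1 / 2 ^ n"
    using power_mult_distrib[of "4::real" 2 n]
    by (simp add: field_simps)
  have "N \<le> 2 * 2 ^ n"
  proof -
    have "(2 :: real) powr (real n * R) \<le> 2 powr real n"
      using R by (intro powr_mono) (auto simp: mult_left_le)
    then show ?thesis using N by (simp add: powr_realpow)
  qed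
  then have N2: "N ^ 2 \<le> 4 * 4 ^ n"
    using power_mono[of N "2 * 2 ^ n" 2] N(1) by (simp add: power_mult_distrib power_mult[symmetric] mult.commute[of n] power_mult[of 2 2])
  have "(real K ^ 2 * \<rho> ^ b) ^ m / 2 ^ (m * b) = real K ^ (2 * m) * ((\<rho> / 2) ^ m) ^ b"
    by (simp add: power_mult_distrib power_divide power_mult[symmetric] mult.commute[of b])
  also have "\<dots> \<le> real K ^ (2 * m) * ((1/8) ^ T) ^ b"
    using \<rho> by (intro mult_left_mono power_mono) auto
  also have "\<dots> \<le> real K ^ (2 * m) * (1/8) ^ n"
    unfolding power_mult[symmetric] using b by (intro mult_left_mono power_decreasing) auto
  finally have "N ^ 2 * real T * ((real K ^ 2 * \<rho> ^ b) ^ m / 2 ^ (m * b))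
      \<le> (4 * 4 ^ n) * real T * (real K ^ (2 * m) * (1/8) ^ n)"
    using N2 \<rho> by (intro mult_mono) auto
  also have "\<dots> = 4 * real T * real K ^ (2 * m) / 2 ^ n"
    using power_mult_distrib[of "4::real" 2 n] by (simp add: field_simps)
  finally have "4 ^ n * (N * real K ^ T) ^ q / 2 ^ (q * M)
      + N ^ 2 * real T * (real K ^ 2 * \<rho> ^ b) ^ m / 2 ^ (m * b)
      \<le> (1 + 4 * real T * real K ^ (2 * m)) / 2 ^ n"
    using A by (simp add: add_divide_distrib)
  also have "\<dots> < 1" using n by simp
  finally show ?thesis .
qed

text \<open>All of \<open>T\<close>, \<open>m\<close>, \<open>q\<close>, \<open>\<gamma>\<close> and
  \<open>K\<close> are fixed before n, so the conditions involving powers of \<open>K\<close> hold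
  for all large n.\<close>

lemma eventually_good_code:
  fixes p R \<epsilon> \<beta> :: real
  assumes p: "0 \<le> p" and \<epsilon>: "0 < \<epsilon>" and R: "0 < R" "R \<le> 1 - 2 * p - \<epsilon>" and \<beta>: "0 < \<beta>"
  shows "\<forall>\<^sub>F n in sequentially. \<exists>Enc Dec. is_code n R Enc Dec \<and> (\<forall>Adv\<in>CE p n. P_max n R Enc Dec Adv < \<beta>)"
proof -
  have \<epsilon>1: "\<epsilon> \<le> 1" and R1: "R \<le> 1" using p R \<epsilon> by auto
  obtain \<rho> where \<rho>: "0 < \<rho>" "\<rho> < 2" and subsets:
    "\<And>C a. finite (C :: nat set) \<Longrightarrow> real a \<le> (1/2 - \<epsilon> / 16) * real (card C) \<Longrightarrow>
      real (card {S\<in>Pow C. card S \<le> a}) \<le> \<rho> ^ card C"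
    using card_small_subsets_less_2_power[of "\<epsilon> / 16", where 'a = nat] \<epsilon> by auto
  \<comment> \<open>This many chunks make a single chunk cost at most n\<epsilon>/16 + 1 of the
    budget.\<close>
  define T where "T = nat \<lceil>16 / \<epsilon>\<rceil>"
  have T: "16 / \<epsilon> \<le> real T" unfolding T_def by linarith
  then have "0 < real T" using \<epsilon> by (smt (verit) divide_pos_pos)
  then have T0: "0 < T" by simp
  obtain m where m: "(\<rho> / 2) ^ m < (1/8) ^ T"
    using real_arch_pow_inv[of "(1/8) ^ T" "\<rho> / 2"] \<rho> by auto
  define q where "q = nat \<lceil>12 / \<epsilon>\<rceil>"
  have q: "12 / \<epsilon> \<le> real q" unfolding q_def by linarith
  define \<gamma> where "\<gamma> = min (1/2) (\<beta> / 3)"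
  have \<gamma>: "0 < \<gamma>" "\<gamma> \<le> 1/2" "2 * \<gamma> < \<beta>" using \<beta> by (auto simp: \<gamma>_def)
  \<comment> \<open>\<open>K\<close> comes after \<open>q\<close> and \<open>m\<close>, which do not
    depend on it; hence there is no circularity.\<close>
  define K where "K = nat \<lceil>real (T * T * (q * m)) / \<gamma>\<rceil> + 1"
  have K: "0 < K" "real (T * T * (q * m)) \<le> \<gamma> * real K"
  proof -
    have "real (T * T * (q * m)) / \<gamma> \<le> real K" unfolding K_def by linarith
    then show "real (T * T * (q * m)) \<le> \<gamma> * real K" using \<gamma>(1) by (simp add: field_simps)
  qed (simp add: K_def)
  have "filterlim (\<lambda>n. real n * \<epsilon>) at_top sequentially" using \<epsilon> by real_asymp
  then have "\<forall>\<^sub>F n in sequentially. 8 * (real T + 2) \<le> real n * \<epsilon>"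
    by (simp add: filterlim_at_top)
  moreover have "filterlim (\<lambda>n. 2 powr (real n * \<epsilon> / 4)) at_top sequentially" using \<epsilon> by real_asymp
  then have "\<forall>\<^sub>F n in sequentially. 2 * real K ^ T \<le> 2 powr (real n * \<epsilon> / 4)"
    by (simp only: filterlim_at_top)
  moreover have "filterlim (\<lambda>n. 2 ^ n :: real) at_top sequentially" by real_asymp
  then have "\<forall>\<^sub>F n in sequentially. 1 + 4 * real T * real K ^ (2 * m) < 2 ^ n"
    by (simp only: filterlim_at_top_dense)
  moreover have "\<forall>\<^sub>F n in sequentially. 1 \<le> n" by (rule eventually_ge_at_top)
  ultimately show ?thesis
  proof eventually_elim
    case (elim n)
    define b where "b = n div T + 1"
    \<comment> \<open>The excess \<epsilon>/2 over R makes the lists short; the other half of the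
      gap up to 1 - 2p is the reserve in \<open>slack_inequality\<close>.\<close>
    define M where "M = nat \<lceil>real n * (R + \<epsilon> / 2)\<rceil>"
    define a where "a = nat \<lfloor>(1/2 - \<epsilon> / 16) * real b\<rfloor>"
    define B where "B = nat \<lfloor>p * real n\<rfloor> + (T * b - n)"
    have b: "0 < b" "n \<le> T * b" "T * b \<le> n + T"
      using T0 dividend_less_times_div[of T n] by (auto simp: b_def)
    have b': "real b \<le> real n / real T + 1" using of_nat_div_le_of_nat[of n T] by (simp add: b_def)
    have M_lo: "real n * (R + \<epsilon> / 2) \<le> real M" unfolding M_def by linarith
    have nR: "0 < real n * (R + \<epsilon> / 2)" using elim R \<epsilon> by simp
    then have M_hi: "real M \<le> real n * (R + \<epsilon> / 2) + 1" unfolding M_def by linarith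
    have M0: "0 < M" using nR M_lo by (cases M) auto
    have "real n * (R + \<epsilon> / 2) \<le> real n" using R p \<epsilon> by (intro mult_left_le) auto
    then have "M \<le> n" unfolding M_def by linarith
    have c: "0 \<le> (1/2 - \<epsilon> / 16) * real b" using \<epsilon>1 by simp
    then have a: "real a \<le> (1/2 - \<epsilon> / 16) * real b" "(1/2 - \<epsilon> / 16) * real b \<le> real a + 1"
      unfolding a_def by linarith+
    have pn: "0 \<le> p * real n" using p by simp
    have B: "real B \<le> p * real n + real T" "p * real n + real (T * b - n) < real B + 1"
    proof -
      have "real (nat \<lfloor>p * real n\<rfloor>) \<le> p * real n" "p * real n < real (nat \<lfloor>p * real n\<rfloor>) + 1"
        using pn by linarith+
      moreover have "real (T * b - n) \<le> real T" using b(3) by simp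
      ultimately show "real B \<le> p * real n + real T" "p * real n + real (T * b - n) < real B + 1"
        unfolding B_def of_nat_add by linarith+
    qed
    have N: "real (card (messages n R)) \<le> 2 * 2 powr (real n * R)"
    proof -
      have "real (nat \<lceil>real n * R\<rceil>) \<le> real n * R + 1" using R by (smt (verit) of_nat_0_le_iff mult_nonneg_nonneg of_nat_nat ceiling_correct zero_le_ceiling)
      then have "2 powr real (nat \<lceil>real n * R\<rceil>) \<le> 2 powr (real n * R + 1)" by (intro powr_mono) auto
      then show ?thesis by (simp add: card_messages powr_realpow powr_add)
    qed
    have fin: "finite (messages n R)" by (simp add: messages_def finite_words)
    have union: "4 ^ n * (real (card (messages n R)) * real K ^ T) ^ q / 2 ^ (q * M)
        + real (card (messages n R)) ^ 2 * real T * (real K ^ 2 * \<rho> ^ b) ^ m / 2 ^ (m * b) < 1"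
      using elim m by (intro union_bound_less_1[OF R1 \<epsilon> \<rho>(1) _ _ N M_lo q b(2)]) auto
    have small: "real (card {S\<in>Pow C. card S \<le> a}) \<le> \<rho> ^ b" if "finite C" "card C = b" for C :: "nat set"
      using subsets[of C a] that a(1) by simp
    show ?case
    proof (rule chunk_code_exists[OF fin b(2) small union])
      fix F assume F:
        "\<And>P v. P \<subseteq> {..<n} \<Longrightarrow> v \<subseteq> P \<Longrightarrow> M \<le> card P \<Longrightarrow>
          card {u\<in>messages n R. \<exists>k\<in>PiE {..<T} (\<lambda>_. {..<K}). \<forall>i\<in>P. (u, i, k (i div b)) \<in> F \<longleftrightarrow> i \<in> v} < q"
        "\<And>u u' i. u \<in> messages n R \<Longrightarrow> u' \<in> messages n R \<Longrightarrow> u \<noteq> u' \<Longrightarrow> i < T \<Longrightarrow>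
          card {\<kappa>\<in>{..<K}. \<exists>\<kappa>'<K. card {s\<in>{i*b..<i*b+b}. ((u, s, \<kappa>) \<in> F) \<noteq> ((u', s, \<kappa>') \<in> F)} \<le> a} < m"
      have "B + M + b \<le> j * b + (T - j) * (a + 1)" if j: "j \<le> T" "M \<le> j * b" for j
      proof -
        have "real n \<le> real T * real b" using b(2) by (metis of_nat_le_iff of_nat_mult)
        then show ?thesis
          using slack_inequality[OF R(2) \<epsilon> \<epsilon>1 T elim(1) b' _ B(1) M_hi a(2) j] by blast
      qed
      moreover have "M \<le> T * b" using \<open>M \<le> n\<close> b(2) by simp
      ultimately have "chunk_code n b T K (messages n R) F M q a m B"
        by (intro chunk_code.intro b(1,2) fin M0 F)
      from code_of_chunk_code[OF this p B(2) K \<gamma>(2,3)]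
      show "\<exists>Enc Dec. is_code n R Enc Dec \<and> (\<forall>Adv\<in>CE p n. P_max n R Enc Dec Adv < \<beta>)" .
    qed
  qed
qed

section \<open>Achievability\<close>

text \<open>This fills the blocklengths that are too short for the construction; the error there is
  immaterial.\<close>

lemma code_exists:
  assumes "R \<le> 1"
  shows "\<exists>Enc Dec. is_code n R Enc Dec"
proof -
  define l where "l = nat \<lceil>real n * R\<rceil>"
  have "real n * R \<le> real n" using assms by (simp add: mult_left_le)
  then have l: "l \<le> n" unfolding l_def by linarith
  have "is_code n R (\<lambda>u. return_pmf (u @ replicate (n - l) False)) (\<lambda>y. return_pmf (replicate l False))"
    using l by (auto simp: is_code_def messages_def words_def l_def)
  then show ?thesis by blast
qed

lemma single_message_code:
  assumes "R \<le> 0"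
  shows "\<exists>Enc Dec. is_code n R Enc Dec \<and> (\<forall>\<beta>>0. \<forall>Adv. P_max n R Enc Dec Adv < \<beta>)"
proof -
  have "real n * R \<le> 0" using assms by (simp add: mult_nonneg_nonpos)
  then have msg: "messages n R = {[]}" by (simp add: messages_def words_def)
  have "is_code n R (\<lambda>_. return_pmf (replicate n False)) (\<lambda>_. return_pmf [])"
    by (auto simp: is_code_def msg words_def)
  moreover have "P_max n R (\<lambda>_. return_pmf (replicate n False)) (\<lambda>_. return_pmf []) Adv = 0" for Adv
    by (simp add: P_max_def msg)
  ultimately show ?thesis by force
qed

text \<open>The codes obtained for the error levels \<open>1 / (m + 1)\<close> are merged into a single sequence by
  using at each blocklength the largest level index \<open>m \<le> n\<close> that can be reached.\<close>

lemma diagonal_codes: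
  assumes ex: "\<And>n. \<exists>c. C n c"
    and ev: "\<And>\<beta> :: real. 0 < \<beta> \<Longrightarrow> \<forall>\<^sub>F n in sequentially. \<exists>c. C n c \<and> E n c \<beta>"
    and mono: "\<And>n c \<beta> \<beta>'. E n c \<beta> \<Longrightarrow> \<beta> \<le> \<beta>' \<Longrightarrow> E n c \<beta>'"
  shows "\<exists>f. (\<forall>n. C n (f n)) \<and> (\<forall>\<beta>>0. \<forall>\<^sub>F n in sequentially. E n (f n) \<beta>)"
proof -
  define Q where "Q n m \<longleftrightarrow> m \<le> n \<and> (\<exists>c. C n c \<and> E n c (1 / real (Suc m)))" for n m
  have "\<exists>c. C n c \<and> (\<forall>m. Q n m \<longrightarrow> E n c (1 / real (Suc m)))" for n
  proof (cases "\<exists>m. Q n m")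
    case True
    have bound: "\<forall>m. Q n m \<longrightarrow> m \<le> n" by (simp add: Q_def)
    define k where "k = Greatest (Q n)"
    have "Q n k" unfolding k_def using True bound by (metis GreatestI_nat)
    then obtain c where c: "C n c" "E n c (1 / real (Suc k))" by (auto simp: Q_def)
    have "E n c (1 / real (Suc m))" if "Q n m" for m
    proof -
      have "m \<le> k" unfolding k_def using that bound by (metis Greatest_le_nat)
      then show ?thesis by (intro mono[OF c(2)]) (simp add: frac_le)
    qed
    then show ?thesis using c by blast
  qed (use ex in blast)
  then obtain f where f: "\<And>n. C n (f n)" "\<And>n m. Q n m \<Longrightarrow> E n (f n) (1 / real (Suc m))" by metis
  have "\<forall>\<^sub>F n in sequentially. E n (f n) \<beta>" if "0 < \<beta>" for \<beta>
  proof -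
    from \<open>0 < \<beta>\<close> obtain m where m: "1 / real (Suc m) < \<beta>"
      by (rule nat_approx_posE)
    have "\<forall>\<^sub>F n in sequentially. \<exists>c. C n c \<and> E n c (1 / real (Suc m))" by (rule ev) simp
    then show ?thesis using eventually_ge_at_top[of m]
    proof eventually_elim
      case (elim n)
      then have "E n (f n) (1 / real (Suc m))" by (intro f(2)) (simp add: Q_def)
      then show ?case by (rule mono) (use m in simp)
    qed
  qed
  then show ?thesis using f(1) by blast
qed

text \<open>\<open>achievable\<close> fixes the code sequence before \<beta>, whereas in
  \<open>ev\<close> the code may depend on \<beta>; \<open>diagonal_codes\<close> bridges this. The
  error property quantifies over all channels, so the threshold is uniform in the channel.\<close>

lemma achievable_of_eventually:
  assumes "0 \<le> R"
    and ex: "\<And>\<epsilon> n. 0 < \<epsilon> \<Longrightarrow> \<exists>Enc Dec. is_code n (R - \<epsilon>) Enc Dec"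
    and ev: "\<And>\<epsilon> \<beta>. 0 < \<epsilon> \<Longrightarrow> 0 < \<beta> \<Longrightarrow> \<forall>\<^sub>F n in sequentially.
      \<exists>Enc Dec. is_code n (R - \<epsilon>) Enc Dec \<and> (\<forall>Adv\<in>CE p n. P_max n (R - \<epsilon>) Enc Dec Adv < \<beta>)"
  shows "achievable p R"
  unfolding achievable_def
proof (intro conjI allI impI)
  fix \<epsilon> :: real assume \<epsilon>: "0 < \<epsilon>"
  let ?C = "\<lambda>n c. is_code n (R - \<epsilon>) (fst c) (snd c)"
  let ?E = "\<lambda>n c \<beta>. \<forall>Adv\<in>CE p n. P_max n (R - \<epsilon>) (fst c) (snd c) Adv < \<beta>"
  have "\<exists>f. (\<forall>n. ?C n (f n)) \<and> (\<forall>\<beta>>0. \<forall>\<^sub>F n in sequentially. ?E n (f n) \<beta>)"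
  proof (rule diagonal_codes)
    show "\<exists>c. ?C n c" for n using ex[OF \<epsilon>] by simp
    show "\<forall>\<^sub>F n in sequentially. \<exists>c. ?C n c \<and> ?E n c \<beta>" if "0 < \<beta>" for \<beta>
      using ev[OF \<epsilon> that] by simp
  qed force
  then obtain f where f: "\<And>n. ?C n (f n)" "\<And>\<beta>. 0 < \<beta> \<Longrightarrow> \<forall>\<^sub>F n in sequentially. ?E n (f n) \<beta>" by blast
  show "\<exists>Enc Dec. (\<forall>n\<ge>1. is_code n (R - \<epsilon>) (Enc n) (Dec n)) \<and>
      (\<forall>\<beta>>0. \<exists>n\<^sub>\<beta>. \<forall>Adv. (\<forall>n\<ge>1. Adv n \<in> CE p n) \<longrightarrow>
         (\<forall>n>n\<^sub>\<beta>. P_max n (R - \<epsilon>) (Enc n) (Dec n) (Adv n) < \<beta>))"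
  proof (intro exI[of _ "fst \<circ> f"] exI[of _ "snd \<circ> f"] conjI allI impI)
    show "is_code n (R - \<epsilon>) ((fst \<circ> f) n) ((snd \<circ> f) n)" for n using f(1) by simp
    fix \<beta> :: real assume "0 < \<beta>"
    then obtain N where N: "\<And>n. N \<le> n \<Longrightarrow> ?E n (f n) \<beta>"
      using f(2) unfolding eventually_sequentially by blast
    show "\<exists>n\<^sub>\<beta>. \<forall>Adv. (\<forall>n\<ge>1. Adv n \<in> CE p n) \<longrightarrow>
        (\<forall>n>n\<^sub>\<beta>. P_max n (R - \<epsilon>) ((fst \<circ> f) n) ((snd \<circ> f) n) (Adv n) < \<beta>)"
      using N by (intro exI[of _ N]) auto
  qed
qed fact

text \<open>The alternative \<open>R = 0\<close> covers p \<ge> 1/2, where R - \<epsilon> is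
  negative and a single message remains.\<close>

lemma achievable_of_le:
  assumes p: "0 \<le> p" and R: "0 \<le> R" "R \<le> 1 - 2 * p \<or> R = 0"
  shows "achievable p R"
proof (rule achievable_of_eventually[OF R(1)])
  fix \<epsilon> :: real assume \<epsilon>: "0 < \<epsilon>"
  show "\<exists>Enc Dec. is_code n (R - \<epsilon>) Enc Dec" for n
    using p R \<epsilon> by (intro code_exists) auto
  fix \<beta> :: real assume \<beta>: "0 < \<beta>"
  show "\<forall>\<^sub>F n in sequentially. \<exists>Enc Dec. is_code n (R - \<epsilon>) Enc Dec \<and>
      (\<forall>Adv\<in>CE p n. P_max n (R - \<epsilon>) Enc Dec Adv < \<beta>)"
  proof (cases "R - \<epsilon> \<le> 0")
    case True
    from single_message_code[OF this] \<beta> show ?thesis by (intro always_eventually allI) blast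
  next
    case False
    then show ?thesis using p R \<epsilon> \<beta> by (intro eventually_good_code[OF p \<epsilon>]) auto
  qed
qed

text \<open>This bounds the set in \<open>capacity\<close>, without which its supremum would not
  dominate the members. Blocklength 1 is enough: an injective code has at most two messages
  there.\<close>

lemma achievable_le_1:
  assumes "achievable p R"
  shows "R \<le> 1"
proof (rule field_le_epsilon)
  fix \<epsilon> :: real assume "0 < \<epsilon>"
  then obtain Enc Dec where "\<And>n. 1 \<le> n \<Longrightarrow> is_code n (R - \<epsilon>) (Enc n) (Dec n)"
    using assms unfolding achievable_def by blast
  from this[of 1] have code: "is_code 1 (R - \<epsilon>) (Enc 1) (Dec 1)" by simp
  define A where "A = messages 1 (R - \<epsilon>)"
  define f where "f u = (SOME x. x \<in> set_pmf (Enc 1 u))" for u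
  have f: "f u \<in> set_pmf (Enc 1 u)" for u
    unfolding f_def using set_pmf_not_empty[of "Enc 1 u"] by (simp add: some_in_eq)
  have "inj_on f A"
  proof (rule inj_onI, rule ccontr)
    fix u u' assume "u \<in> A" "u' \<in> A" "f u = f u'" "u \<noteq> u'"
    moreover from this have "set_pmf (Enc 1 u) \<inter> set_pmf (Enc 1 u') = {}"
      using code by (simp add: is_code_def A_def)
    ultimately show False using f[of u] f[of u'] by auto
  qed
  moreover have "\<forall>u\<in>A. set_pmf (Enc 1 u) \<subseteq> words 1" using code by (simp add: is_code_def A_def)
  then have "f ` A \<subseteq> words 1" using f by (auto dest: bspec subsetD)
  ultimately have "card A \<le> card (words 1 :: bool list set)"
    using finite_words by (rule card_inj_on_le)
  also have "card (words 1 :: bool list set) = 2 ^ 1"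
    using card_lists_length_eq[of "UNIV :: bool set" 1] by (simp add: words_def)
  finally have "nat \<lceil>R - \<epsilon>\<rceil> \<le> 1"
    unfolding A_def card_messages by (subst (asm) power_increasing_iff) simp_all
  then show "R \<le> 1 + \<epsilon>" by linarith
qed

text \<open>The first conjunct certifies that the definite description in \<open>r\<close> denotes
  the intended root.\<close>

theorem theorem2:
  fixes p :: real
  assumes "0 \<le> p" and "p \<le> 1"
  shows "(p1 < p \<and> p < 1/2 \<longrightarrow> (\<exists>!x. x \<in> {0..3/2 * p - 1/2} \<and> G p x = 0)) \<and>
         achievable p (R_L p) \<and> R_L p \<le> capacity p"
proof (intro conjI impI)
  show "\<exists>!x. x \<in> {0..3/2 * p - 1/2} \<and> G p x = 0" if "p1 < p \<and> p < 1/2"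
    using that by (intro G_root_ex1) auto
  show "achievable p (R_L p)"
    using R_L_bounds[OF assms(1)] by (intro achievable_of_le assms) (cases "p < 1/2"; auto)+
  then show "R_L p \<le> capacity p"
    unfolding capacity_def using achievable_le_1 by (intro cSup_upper bdd_aboveI) auto
qed

end
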